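(* For every pair of integers $d\ge 2$ and $r\ge 2$, each of $f^{\mathrm{top}}(d,r)$ and $f^{\mathrm{Haar}}(d,r)$ is at most $\ell$, where $\ell:=\lfloor r/2\rfloor$ if $d\ge 3$ and $\ell:=1$ if $d=2$.
   Context: Let $d,r\ge 2$ be integers. $\mathrm{SO}(d)$ is the group of real special orthogonal $d\times d$ matrices, and $\mathbb{S}^{d-1}=\{x\in\mathbb{R}^d : \|x\|_2=1\}$ is the Euclidean unit sphere, on which $\gamma\in\mathrm{SO}(d)$ acts by matrix multiplication $x\mapsto \gamma x$. Let $\mu$ be the spherical measure on $\mathbb{S}^{d-1}$ (the $(d-1)$-dimensional Hausdorff measure with respect to geodesic distance); it is invariant under $\mathrm{SO}(d)$. The group acts on functions $f:\mathbb{S}^{d-1}\to\mathbb{R}$ by $(\gamma.f)(v):=f(\gamma^{-1}v)$, and this action preserves the real Hilbert space $L^2(\mathbb{S}^{d-1},\mu)$. An $r$-tuple $(\gamma_1,\ldots,\gamma_r)\in\mathrm{SO}(d)^r$ fractionally divides $\mathbb{S}^{d-1}$ if there is $f\in L^2(\mathbb{S}^{d-1},\mu)$ such that $\sum_{i=1}^r\gamma_i.f=1$ $\mu$-almost everywhere and $f$ differs from $1/r$ on a set of positive $\mu$-measure (equivalently, $f$ is not $\mu$-a.e. constant). Let $\mathcal{D}_{d,r}\subseteq\mathrm{SO}(d)^r$ be the set of all $r$-tuples that fractionally divide $\mathbb{S}^{d-1}$. For an integer $0\le \ell\le r$ and an $(r-\ell)$-tuple $\gamma'=(\gamma_{\ell+1},\ldots,\gamma_r)\in\mathrm{SO}(d)^{r-\ell}$,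 define the section $$\mathcal{D}_{d,r}(\gamma'):=\{(\gamma_1,\ldots,\gamma_\ell)\in\mathrm{SO}(d)^\ell : (\gamma_1,\ldots,\gamma_r)\in\mathcal{D}_{d,r}\}.$$ Then $f^{\mathrm{top}}(d,r)$ (resp. $f^{\mathrm{Haar}}(d,r)$) is the smallest integer $\ell$ with $0\le\ell\le r$ such that for every $\gamma'\in\mathrm{SO}(d)^{r-\ell}$ the section $\mathcal{D}_{d,r}(\gamma')$ is a meager (resp. Haar-null) subset of the compact group $\mathrm{SO}(d)^\ell$. (For $\ell=0$ the group $\mathrm{SO}(d)^0$ is the one-point group, whose only meager, resp. null, subset is the empty set.) It is known that $\mathcal{D}_{d,r}$ itself is both meager and null in $\mathrm{SO}(d)^r$, so both quantities are well defined and at most $r$. *)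

theory Defs
  imports "HOL-Probability.Probability_Measure" "HOL-Algebra.Product_Groups"
begin

section \<open>The sphere and its spherical measure\<close>

text \<open>
  The dimension \<open>d\<close> is the cardinality of the index type \<open>'d\<close>; points of the ambient space
  have type \<open>real ^ 'd\<close>.
\<close>

definition geodesic_dist :: "real ^ 'd \<Rightarrow> real ^ 'd \<Rightarrow> real" where
  "geodesic_dist x y = arccos (x \<bullet> y)"

definition ediam :: "('a \<Rightarrow> 'a \<Rightarrow> real) \<Rightarrow> 'a set \<Rightarrow> ennreal" where
  "ediam \<rho> U = (SUP x\<in>U. SUP y\<in>U. ennreal (\<rho> x y))"

text \<open>
  The \<open>s\<close>-dimensional Hausdorff outer measure of a subset of the metric space \<open>(X, \<rho>)\<close>, in the
  normalisation without a volume constant; it is meant for \<open>s \<ge> 1\<close>, since \<open>0 ^ 0 = 1\<close> would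
  count empty members of a cover.
\<close>

definition hausdorff_outer ::
    "'a set \<Rightarrow> ('a \<Rightarrow> 'a \<Rightarrow> real) \<Rightarrow> nat \<Rightarrow> 'a set \<Rightarrow> ennreal" where
  "hausdorff_outer X \<rho> s A =
     (SUP \<delta>\<in>{0<..}.
        INF U\<in>{U :: nat \<Rightarrow> 'a set. (\<forall>i. U i \<subseteq> X \<and> ediam \<rho> (U i) \<le> ennreal \<delta>) \<and> A \<subseteq> (\<Union>i. U i)}.
          (\<Sum>i. ediam \<rho> (U i) ^ s))"

text \<open>
  By Caratheodory's criterion the Hausdorff outer measure is countably additive on the Borel sets
  of the sphere, so the default value of \<^const>\<open>measure_of\<close> for set functions that are not
  measures does not occur here.
\<close>

definition spherical_measure :: "(real ^ 'd) measure" where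
  "spherical_measure =
     measure_of (sphere 0 1) (sets (restrict_space borel (sphere 0 1)))
       (hausdorff_outer (sphere 0 1) geodesic_dist (CARD('d) - 1))"

definition L2 :: "'a measure \<Rightarrow> ('a \<Rightarrow> real) set" where
  "L2 M = {f \<in> borel_measurable M. integrable M (\<lambda>v. (f v)\<^sup>2)}"

section \<open>The groups \<open>SO(d)\<close> and \<open>SO(d)\<^sup>I\<close>\<close>

definition SO :: "(real ^ 'd ^ 'd) set" where
  "SO = {A. rotation_matrix A}"

definition SO_group :: "(real ^ 'd ^ 'd) monoid" where
  "SO_group = \<lparr>carrier = SO, mult = (**), one = mat 1\<rparr>"

text \<open>
  Tuples indexed by a set \<open>I\<close> of positive integers are extensional functions on \<open>I\<close>; for
  \<open>I = {}\<close> the only one is \<open>\<lambda>_. undefined\<close>.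
\<close>

definition SO_tuples :: "nat set \<Rightarrow> (nat \<Rightarrow> real ^ 'd ^ 'd) set" where
  "SO_tuples I = (\<Pi>\<^sub>E i\<in>I. SO)"

definition SO_power :: "nat set \<Rightarrow> (nat \<Rightarrow> real ^ 'd ^ 'd) monoid" where
  "SO_power I = product_group I (\<lambda>_. SO_group)"

definition SO_power_top :: "nat set \<Rightarrow> (nat \<Rightarrow> real ^ 'd ^ 'd) topology" where
  "SO_power_top I = product_topology (\<lambda>_. top_of_set SO) I"

section \<open>Meager and Haar-null sets\<close>

definition nowhere_dense_in :: "'a topology \<Rightarrow> 'a set \<Rightarrow> bool" where
  "nowhere_dense_in T A \<longleftrightarrow> A \<subseteq> topspace T \<and> T interior_of (T closure_of A) = {}"

definition meager_in :: "'a topology \<Rightarrow> 'a set \<Rightarrow> bool" where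
  "meager_in T A \<longleftrightarrow> (\<exists>N :: nat \<Rightarrow> 'a set. (\<forall>n. nowhere_dense_in T (N n)) \<and> A = (\<Union>n. N n))"

text \<open>
  Normalised left-invariant Borel measures; on a compact metrizable group there is exactly one,
  and it is also right-invariant and regular.
\<close>

definition haar_probability :: "('a, 'b) monoid_scheme \<Rightarrow> 'a topology \<Rightarrow> 'a measure \<Rightarrow> bool" where
  "haar_probability G T M \<longleftrightarrow>
     prob_space M \<and> space M = topspace T \<and> sets M = sigma_sets (topspace T) {U. openin T U} \<and>
     (\<forall>g\<in>carrier G. \<forall>B\<in>sets M. emeasure M ((\<lambda>x. g \<otimes>\<^bsub>G\<^esub> x) ` B) = emeasure M B)"

text \<open>
  Since the Haar probability measure is unique, the existential quantifier just names it;
  a universal one would be vacuous if no such measure existed.  The completion is taken because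
  the sets in question are not assumed to be Borel.
\<close>

definition haar_null :: "('a, 'b) monoid_scheme \<Rightarrow> 'a topology \<Rightarrow> 'a set \<Rightarrow> bool" where
  "haar_null G T A \<longleftrightarrow> (\<exists>M. haar_probability G T M \<and> A \<in> null_sets (completion M))"

section \<open>Fractional division\<close>

definition act :: "real ^ 'd ^ 'd \<Rightarrow> (real ^ 'd \<Rightarrow> real) \<Rightarrow> real ^ 'd \<Rightarrow> real" where
  "act \<gamma> f = (\<lambda>v. f (matrix_inv \<gamma> *v v))"

definition fractionally_divides :: "nat \<Rightarrow> (nat \<Rightarrow> real ^ 'd ^ 'd) \<Rightarrow> bool" where
  "fractionally_divides r \<gamma> \<longleftrightarrow>
     (\<exists>f \<in> L2 spherical_measure.
        (AE v in spherical_measure. (\<Sum>i=1..r. act (\<gamma> i) f v) = 1) \<and>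
        emeasure spherical_measure {v \<in> space spherical_measure. f v \<noteq> 1 / real r} > 0)"

definition dividing_tuples :: "nat \<Rightarrow> (nat \<Rightarrow> real ^ 'd ^ 'd) set" where
  "dividing_tuples r = {\<gamma> \<in> SO_tuples {1..r}. fractionally_divides r \<gamma>}"

text \<open>
  Here \<open>\<gamma>'\<close> is a tuple indexed by \<open>{l + 1..r}\<close>, and \<^const>\<open>merge\<close> concatenates the two tuples.
\<close>

definition dividing_section ::
    "nat \<Rightarrow> nat \<Rightarrow> (nat \<Rightarrow> real ^ 'd ^ 'd) \<Rightarrow> (nat \<Rightarrow> real ^ 'd ^ 'd) set" where
  "dividing_section r l \<gamma>' =
     {\<alpha> \<in> SO_tuples {1..l}. merge {1..l} {l + 1..r} (\<alpha>, \<gamma>') \<in> dividing_tuples r}"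

text \<open>The dimension \<open>d = CARD('d)\<close> is passed as the type argument \<open>TYPE('d)\<close>.\<close>

definition f_top :: "'d::finite itself \<Rightarrow> nat \<Rightarrow> nat" where
  "f_top D r =
     (LEAST l. l \<le> r \<and>
        (\<forall>\<gamma>' :: nat \<Rightarrow> real ^ 'd ^ 'd. \<gamma>' \<in> SO_tuples {l + 1..r} \<longrightarrow>
           meager_in (SO_power_top {1..l}) (dividing_section r l \<gamma>')))"

definition f_haar :: "'d::finite itself \<Rightarrow> nat \<Rightarrow> nat" where
  "f_haar D r =
     (LEAST l. l \<le> r \<and>
        (\<forall>\<gamma>' :: nat \<Rightarrow> real ^ 'd ^ 'd. \<gamma>' \<in> SO_tuples {l + 1..r} \<longrightarrow>
           haar_null (SO_power {1..l}) (SO_power_top {1..l}) (dividing_section r l \<gamma>')))"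

end

theory Submission
  imports "Jordan_Normal_Form.Determinant" "HOL-Computational_Algebra.Polynomial" Defs
begin

text \<open>
  Suppose that \<open>f\<close> witnesses that \<open>(\<gamma>\<^sub>1, \<dots>, \<gamma>\<^sub>r)\<close> fractionally divides the sphere, and put
  \<open>h = f - 1/r\<close>.  Then \<open>h\<close> is integrable and nonzero, and \<open>\<gamma>\<^sub>1.h + \<dots> + \<gamma>\<^sub>r.h = 0\<close>.  For each
  degree \<open>n\<close>, the moments \<open>\<integral> h(v) v\<^bsub>k\<^sub>1\<^esub> \<dots> v\<^bsub>k\<^sub>n\<^esub> d\<mu>\<close> form a tensor of order \<open>n\<close> that is annihilated
  by \<open>T\<^sub>n = \<gamma>\<^sub>1\<^bsup>\<otimes>n\<^esup> + \<dots> + \<gamma>\<^sub>r\<^bsup>\<otimes>n\<^esup>\<close>.  By the Stone-Weierstrass theorem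
  some moment is nonzero (\<open>AE_zero_if_moments_zero\<close>).  So every dividing tuple lies in one of the
  countably many zero sets \<open>det T\<^sub>n = 0\<close>, and \<open>det T\<^sub>n\<close> is a polynomial in the matrix entries.

  Fix \<open>\<gamma>\<^bsub>l+1\<^esub>, \<dots>, \<gamma>\<^sub>r\<close> with \<open>l = \<lfloor>r/2\<rfloor>\<close> and choose \<open>\<gamma>\<^sub>1 = \<dots> = \<gamma>\<^sub>l = \<gamma>\<^bsub>l+1\<^esub>\<close>.  Then more than half of the
  summands of \<open>T\<^sub>n\<close> are one and the same isometry, so that the remaining ones cannot cancel them,
  and \<open>T\<^sub>n\<close> is injective (\<open>sum_tensor_act_injective\<close>).  Hence none of these polynomials
  vanishes identically on \<open>SO(d)\<^sup>l\<close>.  For \<open>d = 2\<close> one free rotation suffices: in complex notation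
  the rotation \<open>\<gamma>\<^sub>i\<close> is multiplication by a unit complex number \<open>\<omega>\<^sub>i\<close>, some Fourier coefficient of
  \<open>h\<close> is nonzero, and so \<open>\<omega>\<^sub>1\<^sup>k + \<dots> + \<omega>\<^sub>r\<^sup>k = 0\<close> for some \<open>k\<close>, which fails for some value of \<open>\<omega>\<^sub>1\<close>.

  It remains to see that a polynomial \<open>F\<close> in the entries which does not vanish identically on
  \<open>SO(d)\<^sup>I\<close> has a closed zero set \<open>Z\<close> of Haar measure zero (\<open>zero_set_null\<close>); since nonempty open
  sets have positive measure, \<open>Z\<close> is then also nowhere dense.  Join the identity to a product of two
  reflections by moving one of the two normal vectors along a straight line, and let this curve
  translate a point \<open>x\<close>: along the curve, \<open>F\<close> is a rational function of the parameter, so that it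
  has finitely many zeros or vanishes throughout.  By invariance of the measure, almost
  every \<open>x \<in> Z\<close> is of the second kind, so the product of the two reflections maps almost all of \<open>Z\<close>
  into \<open>Z\<close>.  Such products generate \<open>SO(d)\<close> by the theorem of Cartan and Dieudonne (\<open>SO_induct\<close>),
  hence \<open>Z\<close> is almost invariant under every translation.  By compactness, finitely many
  translations suffice to move any point off \<open>Z\<close>, so \<open>Z\<close> is null.

  Haar measure on \<open>SO(d)\<close> is constructed by orthonormalising the columns of a random matrix; on a
  power it is the product measure.
\<close>

text \<open>
  Both symbols are to denote components and inner products in Euclidean space, not the operations on
  vectors of variable dimension that accompany determinants of variable size.
\<close>

no_notation Matrix.vec_index (infixl "$" 100)
no_notation Matrix.scalar_prod (infix "\<bullet>" 70)

section \<open>Reflections generate the rotation group\<close>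

text \<open>
  The matrix of the reflection in the hyperplane orthogonal to \<open>u\<close>; it is the identity for \<open>u = 0\<close>.
\<close>

definition householder :: "real ^ 'd \<Rightarrow> real ^ 'd ^ 'd" where
  "householder u = (\<chi> i j. (if i = j then 1 else 0) - 2 * u $ i * u $ j / (u \<bullet> u))"

lemma householder_mult_vec:
  "householder u *v x = x - (2 * (u \<bullet> x) / (u \<bullet> u)) *\<^sub>R u"
proof -
  have "(\<Sum>j\<in>UNIV. 2 * u $ i * u $ j / (u \<bullet> u) * x $ j) = 2 * (u \<bullet> x) / (u \<bullet> u) * u $ i" for i
    by (simp add: inner_vec_def[of u x] sum_distrib_left sum_distrib_right sum_divide_distrib
        algebra_simps)
  then show ?thesis
    by (simp add: vec_eq_iff householder_def matrix_vector_mult_def left_diff_distrib sum_subtractf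
        if_distrib[of "\<lambda>a. a * _"] cong: if_cong)
qed

lemma transpose_householder: "transpose (householder u) = householder u"
  by (simp add: vec_eq_iff householder_def transpose_def mult.commute mult.left_commute)

lemma householder_involution:
  assumes "u \<noteq> 0" shows "householder u ** householder u = mat 1"
proof -
  have "u \<bullet> u \<noteq> 0" using assms by simp
  then have "householder u *v (householder u *v x) = x" for x
    by (simp add: householder_mult_vec inner_diff_right field_simps scaleR_left_distrib[symmetric])
  then show ?thesis
    by (metis matrix_eq matrix_vector_mul_assoc matrix_vector_mul_lid)
qed

lemma orthogonal_householder: "u \<noteq> 0 \<Longrightarrow> orthogonal_matrix (householder u)"
  by (simp add: orthogonal_matrix transpose_householder householder_involution)

lemma orthogonal_matrix_mult_vec_inner:
  fixes Q :: "real ^ 'd ^ 'd"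
  assumes "orthogonal_matrix Q" shows "(Q *v x) \<bullet> (Q *v y) = x \<bullet> y"
  by (metis assms matrix_of_matrix_vector_mul matrix_vector_mul_linear orthogonal_transformation_matrix orthogonal_transformation_def)

lemma orthogonal_matrix_mult_vec_norm:
  fixes Q :: "real ^ 'd ^ 'd"
  assumes "orthogonal_matrix Q" shows "norm (Q *v x) = norm x"
  by (simp add: norm_eq_sqrt_inner orthogonal_matrix_mult_vec_inner assms)

text \<open>
  An orthogonal matrix that carries a coordinate axis to the line of \<open>u\<close> conjugates the reflection
  along that axis, which is diagonal, into this one.
\<close>

lemma det_householder:
  fixes u :: "real ^ 'd"
  assumes "u \<noteq> 0" shows "det (householder u) = - 1"
proof -
  fix k :: 'd
  define a where "a = (1 / norm u) *\<^sub>R u"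
  have "norm a = 1" using assms by (simp add: a_def)
  then obtain Q where Q: "orthogonal_matrix Q" "Q *v axis k 1 = a"
    using orthogonal_matrix_exists_basis by metis
  let ?D = "householder (axis k 1 :: real ^ 'd)"
  have ua: "householder u *v x = x - (2 * (a \<bullet> x)) *\<^sub>R a" for x
    by (simp add: householder_mult_vec a_def dot_square_norm power2_eq_square field_simps)
  have *: "Q ** ?D = householder u ** Q"
  proof -
    have "Q *v (?D *v x) = householder u *v (Q *v x)" for x
    proof -
      have "a \<bullet> (Q *v x) = axis k 1 \<bullet> x"
        using orthogonal_matrix_mult_vec_inner[OF Q(1), of "axis k 1" x] by (simp add: Q(2))
      moreover have "a \<bullet> a = 1" using \<open>norm a = 1\<close> by (simp add: norm_eq_1)
      ultimately show ?thesis
        by (simp only: ua, simp add: householder_mult_vec matrix_vector_mult_diff_distrib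
            matrix_vector_mult_scaleR Q(2) inner_axis_axis)
    qed
    then show ?thesis by (simp add: matrix_eq matrix_vector_mul_assoc[symmetric])
  qed
  have "det ?D = prod (\<lambda>i. ?D $ i $ i) UNIV"
    by (rule det_diagonal) (auto simp: householder_def axis_def)
  also have "\<dots> = prod (\<lambda>i. if i = k then - 1 else 1) UNIV"
    by (rule prod.cong) (auto simp: householder_def axis_def inner_axis_axis[unfolded axis_def])
  also have "\<dots> = - 1" by simp
  finally have "det Q * (- 1) = det Q * det (householder u)"
    using arg_cong[OF *, of det] by (simp add: det_mul)
  moreover have "det Q \<noteq> 0" using det_orthogonal_matrix[OF Q(1)] by auto
  ultimately show ?thesis by (metis mult_left_cancel)
qed

lemma SO_iff: "A \<in> SO \<longleftrightarrow> orthogonal_matrix A \<and> det A = 1"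
  by (simp add: SO_def rotation_matrix_def)

lemma SO_one: "mat 1 \<in> SO"
  by (simp add: SO_iff orthogonal_matrix_id)

lemma SO_mult: "A \<in> SO \<Longrightarrow> B \<in> SO \<Longrightarrow> A ** B \<in> SO"
  by (simp add: SO_iff orthogonal_matrix_mul det_mul)

lemma SO_transpose: "A \<in> SO \<Longrightarrow> transpose A \<in> SO"
  by (simp add: SO_iff orthogonal_matrix_transpose)

lemma SO_transpose_mult: "A \<in> SO \<Longrightarrow> transpose A ** A = mat 1" "A \<in> SO \<Longrightarrow> A ** transpose A = mat 1"
  by (auto simp: SO_iff orthogonal_matrix_def)

text \<open>
  If \<open>Q v \<noteq> v\<close>, then the reflection along \<open>Q v - v\<close> takes \<open>Q v\<close> back to \<open>v\<close>.  Vectors fixed by \<open>Q\<close> are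
  orthogonal to \<open>Q v - v\<close>, because \<open>Q\<close> preserves inner products; so they remain fixed.
\<close>

lemma householder_fixes_more:
  fixes Q :: "real ^ 'd ^ 'd"
  assumes Q: "orthogonal_matrix Q" and "Q \<noteq> mat 1"
  obtains u where "u \<noteq> 0" "dim {x. Q *v x = x} < dim {x. (householder u ** Q) *v x = x}"
proof -
  obtain v where v: "Q *v v \<noteq> v"
    using \<open>Q \<noteq> mat 1\<close> by (auto simp: matrix_eq)
  define u where "u = Q *v v - v"
  have u: "u \<noteq> 0" using v by (simp add: u_def)
  have vv: "householder u *v (Q *v v) = v"
  proof -
    have i: "(Q *v v) \<bullet> (Q *v v) = v \<bullet> v" by (rule orthogonal_matrix_mult_vec_inner[OF Q])
    have e: "2 * (u \<bullet> (Q *v v)) = u \<bullet> u"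
      by (simp add: u_def inner_diff i inner_commute)
    have "householder u *v (Q *v v) = Q *v v - (2 * (u \<bullet> (Q *v v)) / (u \<bullet> u)) *\<^sub>R u"
      by (rule householder_mult_vec)
    also have "\<dots> = Q *v v - 1 *\<^sub>R u"
      unfolding e using u by (simp only: divide_self inner_eq_zero_iff not_False_eq_True)
    finally have "householder u *v (Q *v v) = Q *v v - 1 *\<^sub>R u" .
    then show ?thesis by (simp add: u_def)
  qed
  have ww: "householder u *v (Q *v w) = w" if "Q *v w = w" for w
  proof -
    have "u \<bullet> w = 0"
      using orthogonal_matrix_mult_vec_inner[OF Q, of v w] that by (simp add: u_def inner_diff)
    then show ?thesis by (simp add: householder_mult_vec that)
  qed
  have sub: "subspace {x. A *v x = x}" for A :: "real ^ 'd ^ 'd"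
    by (auto simp: subspace_def matrix_vector_right_distrib matrix_vector_mult_scaleR)
  have "{x. Q *v x = x} \<subset> {x. (householder u ** Q) *v x = x}"
    using v vv ww by (auto simp: matrix_vector_mul_assoc[symmetric])
  then have "dim {x. Q *v x = x} < dim {x. (householder u ** Q) *v x = x}"
    by (intro dim_psubset) (simp only: sub[THEN span_eq_iff[THEN iffD2]])
  with u show ?thesis by (rule that)
qed

text \<open>
  The theorem of Cartan and Dieudonne for rotations, as an induction rule.  The reflections come in
  pairs: after a first one the determinant is \<open>-1\<close>, so the matrix is not the identity and a second
  reflection can enlarge its fixed space further.
\<close>

lemma SO_induct [consumes 1, case_names one step]:
  fixes Q :: "real ^ 'd ^ 'd"
  assumes "Q \<in> SO" and one: "P (mat 1)"
    and step: "\<And>u v Q. u \<noteq> 0 \<Longrightarrow> v \<noteq> 0 \<Longrightarrow> Q \<in> SO \<Longrightarrow> P Q \<Longrightarrow> P (householder v ** householder u ** Q)"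
  shows "P Q"
  using assms(1)
proof (induction "CARD('d) - dim {x. Q *v x = x}" arbitrary: Q rule: less_induct)
  case less
  have le: "dim {x. A *v x = x} \<le> CARD('d)" for A :: "real ^ 'd ^ 'd"
    using dim_subset_UNIV_cart by blast
  show ?case
  proof (cases "Q = mat 1")
    case True then show ?thesis using one by simp
  next
    case False
    have Q: "orthogonal_matrix Q" "det Q = 1" using less.prems by (auto simp: SO_iff)
    obtain v where v: "v \<noteq> 0" "dim {x. Q *v x = x} < dim {x. (householder v ** Q) *v x = x}"
      using householder_fixes_more[OF Q(1) False] .
    let ?R = "householder v ** Q"
    have R: "orthogonal_matrix ?R" "det ?R = - 1"
      using Q v by (auto simp: orthogonal_matrix_mul orthogonal_householder det_mul det_householder)
    then have "?R \<noteq> mat 1" by auto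
    then obtain u where u: "u \<noteq> 0" "dim {x. ?R *v x = x} < dim {x. (householder u ** ?R) *v x = x}"
      using householder_fixes_more[OF R(1)] by blast
    let ?S = "householder u ** ?R"
    have S: "?S \<in> SO"
      using R u by (auto simp: SO_iff orthogonal_matrix_mul orthogonal_householder det_mul det_householder)
    have "P ?S"
      by (rule less.hyps[OF _ S]) (use u v le[of ?S] in linarith)
    then have "P (householder v ** householder u ** ?S)" by (rule step[OF u(1) v(1) S])
    also have "householder v ** householder u ** ?S = Q"
    proof -
      have "householder v ** householder u ** ?S
          = householder v ** (householder u ** householder u) ** householder v ** Q"
        by (simp add: matrix_mul_assoc)
      then show ?thesis by (simp add: householder_involution u(1) v(1))
    qed
    finally show ?thesis .
  qed
qed

section \<open>Haar measure on the rotation group\<close>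

lemma nn_integral_lborel_translate:
  fixes t :: "'a::euclidean_space"
  assumes [measurable]: "g \<in> borel_measurable borel"
  shows "(\<integral>\<^sup>+y. g (t + y) \<partial>lborel) = (\<integral>\<^sup>+y. g y \<partial>lborel)"
  by (subst (2) lborel_affine[of 1 t]) (auto simp: density_1 nn_integral_distr one_ennreal_def[symmetric])

lemma nn_integral_lborel_reflect:
  fixes t :: "'a::euclidean_space"
  assumes [measurable]: "g \<in> borel_measurable borel"
  shows "(\<integral>\<^sup>+y. g (t - y) \<partial>lborel) = (\<integral>\<^sup>+y. g y \<partial>lborel)"
  by (subst (2) lborel_affine[of "-1" t]) (auto simp: density_1 nn_integral_distr one_ennreal_def[symmetric])

lemma orthogonal_transformation_measurable:
  fixes f :: "'a::euclidean_space \<Rightarrow> 'a"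
  assumes "orthogonal_transformation f"
  shows "f \<in> borel_measurable borel"
  using assms by (intro borel_measurable_continuous_onI linear_continuous_on)
    (simp add: orthogonal_transformation_linear linear_conv_bounded_linear[symmetric])

text \<open>
  This is the uniqueness argument for Haar measure.  For Borel sets \<open>A\<close> and \<open>B\<close>, Fubini's theorem and
  translation invariance give \<open>\<lambda>(f\<^sup>-\<^sup>1 A) \<lambda>(B) = \<lambda>(A) \<lambda>(f\<^sup>-\<^sup>1 B)\<close>; for the unit ball \<open>B\<close>, which \<open>f\<close>
  preserves, the factor \<open>\<lambda>(B)\<close> cancels.
\<close>

lemma lborel_orthogonal_invariant:
  fixes f :: "'a::euclidean_space \<Rightarrow> 'a"
  assumes f: "orthogonal_transformation f"
  shows "distr lborel borel f = lborel"
proof (rule measure_eqI)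
  fix A assume "A \<in> sets (distr lborel borel f)"
  then have A[measurable]: "A \<in> sets borel" by simp
  note [measurable] = orthogonal_transformation_measurable[OF f]
  have lin: "linear f" using f by (rule orthogonal_transformation_linear)
  obtain g where fg: "\<And>x. f (g x) = x"
    using orthogonal_transformation_surj[OF f] by (metis surjD)
  define B where "B = ball (0::'a) 1"
  have B[measurable]: "B \<in> sets borel" by (simp add: B_def)
  let ?A = "indicator A :: 'a \<Rightarrow> ennreal" and ?B = "indicator B :: 'a \<Rightarrow> ennreal"
  have "(\<integral>\<^sup>+x. ?A (f x) \<partial>lborel) * (\<integral>\<^sup>+y. ?B y \<partial>lborel)
      = (\<integral>\<^sup>+x. \<integral>\<^sup>+y. ?A (f x) * ?B y \<partial>lborel \<partial>lborel)"
    by (simp add: nn_integral_cmult nn_integral_multc)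
  also have "\<dots> = (\<integral>\<^sup>+x. \<integral>\<^sup>+y. ?A (f x) * ?B (f x + y) \<partial>lborel \<partial>lborel)"
    by (subst nn_integral_lborel_translate[where g = "\<lambda>z. ?A _ * ?B z"]) auto
  also have "\<dots> = (\<integral>\<^sup>+y. \<integral>\<^sup>+x. ?A (f x) * ?B (f x + y) \<partial>lborel \<partial>lborel)"
    by (rule lborel_pair.Fubini'[symmetric]) measurable
  also have "\<dots> = (\<integral>\<^sup>+y. \<integral>\<^sup>+x. ?A (f (- g y + x)) * ?B (f (- g y + x) + y) \<partial>lborel \<partial>lborel)"
    by (subst nn_integral_lborel_translate[where g = "\<lambda>z. ?A (f z) * ?B (f z + _)"]) auto
  also have "\<dots> = (\<integral>\<^sup>+y. \<integral>\<^sup>+x. ?A (f x - y) * ?B (f x) \<partial>lborel \<partial>lborel)"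
    by (simp add: linear_add[OF lin] linear_diff[OF lin] fg)
  also have "\<dots> = (\<integral>\<^sup>+x. \<integral>\<^sup>+y. ?A (f x - y) * ?B (f x) \<partial>lborel \<partial>lborel)"
    by (rule lborel_pair.Fubini') measurable
  also have "\<dots> = (\<integral>\<^sup>+x. \<integral>\<^sup>+y. ?A y * ?B (f x) \<partial>lborel \<partial>lborel)"
    by (subst nn_integral_lborel_reflect[where g = "\<lambda>z. ?A z * ?B _"]) auto
  also have "\<dots> = (\<integral>\<^sup>+y. ?A y \<partial>lborel) * (\<integral>\<^sup>+x. ?B (f x) \<partial>lborel)"
    by (simp add: nn_integral_cmult nn_integral_multc)
  also have "(\<lambda>x. ?B (f x)) = ?B"
    by (simp add: fun_eq_iff B_def indicator_def orthogonal_transformation_norm[OF f])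
  finally have "(\<integral>\<^sup>+x. ?A (f x) \<partial>lborel) * emeasure lborel B = emeasure lborel A * emeasure lborel B"
    by simp
  moreover have "emeasure lborel B \<noteq> 0"
    unfolding B_def using content_ball_gt_0_iff[of "0::'a" 1] by (auto simp: measure_def)
  moreover have "emeasure lborel B < \<infinity>"
    unfolding B_def by (rule emeasure_bounded_finite) auto
  ultimately have "(\<integral>\<^sup>+x. ?A (f x) \<partial>lborel) = emeasure lborel A"
    by (auto simp: mult.commute[of _ "emeasure lborel B"] ennreal_mult_cancel_left)
  then show "emeasure (distr lborel borel f) A = emeasure lborel A"
    by (simp add: nn_integral_distr flip: nn_integral_indicator)
qed simp

text \<open>
  An arbitrary numbering of the index type, which fixes the order of orthonormalisation.
\<close>

abbreviation idx :: "'d::finite \<Rightarrow> nat" where "idx \<equiv> to_nat_on (UNIV :: 'd set)"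

lemma idx_eq: "idx i = idx j \<longleftrightarrow> i = j"
  by (simp add: countable_finite)

text \<open>
  With this congruence rule, recursive calls under a sum know the range of the summation index.
\<close>

declare sum.cong [fundef_cong]

text \<open>
  As \<open>sgn 0 = 0\<close>, the recursion also makes sense for dependent families, and it is measurable in the
  family without a case distinction.
\<close>

function gram_schmidt :: "('d::finite \<Rightarrow> 'v::real_inner) \<Rightarrow> 'd \<Rightarrow> 'v" where
  "gram_schmidt a j =
     sgn (a j - (\<Sum>i\<in>{i::'d. idx i < idx j}. (a j \<bullet> gram_schmidt a i) *\<^sub>R gram_schmidt a i))"
  by pat_completeness auto
termination by (relation "Wellfounded.measure (\<lambda>(a, j). idx j)") auto

declare gram_schmidt.simps [simp del]

lemma gram_schmidt_linear_isometry:
  assumes f: "linear f" and inner: "\<And>x y. f x \<bullet> f y = x \<bullet> y"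
  shows "gram_schmidt (\<lambda>j. f (a j)) j = f (gram_schmidt a j)"
proof (induction "idx j" arbitrary: j rule: less_induct)
  case less
  have sgn: "sgn (f y) = f (sgn y)" for y
    by (simp add: sgn_div_norm linear_cmul[OF f] norm_eq_sqrt_inner inner)
  show ?case
    by (subst (1 2) gram_schmidt.simps)
       (simp add: less inner linear_diff[OF f] linear_sum[OF f] linear_cmul[OF f] flip: sgn)
qed

text \<open>
  The claim about spans serves the induction: it shows that the vector to be normalised is
  nonzero, since otherwise \<open>a j\<close> would lie in the span of the earlier vectors.
\<close>

lemma gram_schmidt_orthonormal:
  fixes a :: "'d::finite \<Rightarrow> 'v::real_inner"
  assumes inj: "inj a" and indep: "independent (range a)"
  shows "norm (gram_schmidt a j) = 1 \<and> gram_schmidt a j \<in> span (a ` {i::'d. idx i \<le> idx j}) \<and>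
         (\<forall>i::'d. idx i < idx j \<longrightarrow> gram_schmidt a j \<bullet> gram_schmidt a i = 0)"
proof (induction "idx j" arbitrary: j rule: less_induct)
  case less
  let ?g = "gram_schmidt a"
  define y where "y = a j - (\<Sum>i\<in>{i::'d. idx i < idx j}. (a j \<bullet> ?g i) *\<^sub>R ?g i)"
  have g: "?g j = sgn y" unfolding y_def by (rule gram_schmidt.simps)
  have in_span: "(\<Sum>i\<in>{i::'d. idx i < idx j}. (a j \<bullet> ?g i) *\<^sub>R ?g i) \<in> span (a ` {i::'d. idx i < idx j})"
  proof (intro span_sum span_mul)
    fix i assume "i \<in> {i::'d. idx i < idx j}"
    then have "?g i \<in> span (a ` {k::'d. idx k \<le> idx i})" using less by blast
    then show "?g i \<in> span (a ` {i::'d. idx i < idx j})"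
      by (rule subsetD[OF span_mono, rotated]) (use \<open>i \<in> _\<close> in auto)
  qed
  have "y \<noteq> 0"
  proof
    assume "y = 0"
    then have "a j \<in> span (a ` {i::'d. idx i < idx j})" using in_span by (simp add: y_def)
    moreover have "a ` {i::'d. idx i < idx j} \<subseteq> range a - {a j}"
      using inj by (auto dest: injD)
    ultimately have "a j \<in> span (range a - {a j})" using span_mono by blast
    with indep show False by (auto simp: dependent_def)
  qed
  then have n: "norm (?g j) = 1" by (simp add: g norm_sgn)
  have "y \<in> span (a ` {i::'d. idx i \<le> idx j})"
    unfolding y_def
    by (intro span_diff span_base subsetD[OF span_mono in_span]) auto
  then have s: "?g j \<in> span (a ` {i::'d. idx i \<le> idx j})"
    by (simp add: g sgn_div_norm span_mul)
  have "y \<bullet> ?g i = 0" if i: "idx i < idx j" for i :: 'd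
  proof -
    have "?g k \<bullet> ?g i = (if k = i then 1 else 0)" if "idx k < idx j" for k :: 'd
      using less[OF i] less[OF that] 
      by (cases "idx k" "idx i" rule: linorder_cases)
         (auto simp: idx_eq norm_eq_1 inner_commute)
    then have "(\<Sum>k\<in>{k::'d. idx k < idx j}. (a j \<bullet> ?g k) * (?g k \<bullet> ?g i))
        = (\<Sum>k\<in>{k::'d. idx k < idx j}. if k = i then a j \<bullet> ?g k else 0)"
      by (intro sum.cong) auto
    also have "\<dots> = a j \<bullet> ?g i" using i by simp
    finally show ?thesis by (simp add: y_def inner_diff_left inner_sum_left)
  qed
  then have "?g j \<bullet> ?g i = 0" if "idx i < idx j" for i :: 'd
    using that by (simp add: g sgn_div_norm)
  with n s show ?case by blast
qed

lemma gram_schmidt_inner: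
  fixes a :: "'d::finite \<Rightarrow> 'v::real_inner"
  assumes "inj a" and "independent (range a)"
  shows "gram_schmidt a i \<bullet> gram_schmidt a j = (if i = j then 1 else 0)"
proof -
  note * = gram_schmidt_orthonormal[OF assms]
  consider "idx i < idx j" | "i = j" | "idx j < idx i" by (metis idx_eq linorder_neqE_nat)
  then show ?thesis
  proof cases
    case 1 then show ?thesis using *[of j] by (auto simp: inner_commute)
  next
    case 2 then show ?thesis using *[of j] by (simp add: norm_eq_1)
  next
    case 3 then show ?thesis using *[of i] by auto
  qed
qed

definition orthonormalize :: "real ^ 'd ^ 'd \<Rightarrow> real ^ 'd ^ 'd" where
  "orthonormalize A = (\<chi> i j. gram_schmidt (\<lambda>k. column k A) j $ i)"

lemma orthogonal_orthonormalize:
  fixes A :: "real ^ 'd ^ 'd"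
  assumes "det A \<noteq> 0" shows "orthogonal_matrix (orthonormalize A)"
proof -
  have inj: "inj (\<lambda>k. column k A)"
    using assms det_identical_columns[of _ _ A] by (auto intro!: injI)
  have "range (\<lambda>k. column k A) = columns A" by (auto simp: columns_def)
  then have ind: "independent (range (\<lambda>k. column k A))"
    using assms det_dependent_columns[of A] by (auto simp: dependent_vec_eq)
  have c: "column j (orthonormalize A) = gram_schmidt (\<lambda>k. column k A) j" for j
    by (simp add: orthonormalize_def column_def vec_eq_iff)
  show ?thesis
    by (simp add: orthogonal_matrix_orthonormal_columns c orthogonal_def norm_eq_1
        gram_schmidt_inner[OF inj ind])
qed

text \<open>
  Left multiplication by \<open>g\<close> acts on each column by the isometry \<open>g\<close>, and orthonormalisation
  only uses inner products and linear combinations.  This equivariance is what makes the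
  distribution of an orthonormalised random matrix invariant.
\<close>

lemma orthonormalize_mult:
  fixes g :: "real ^ 'd ^ 'd"
  assumes "orthogonal_matrix g"
  shows "orthonormalize (g ** A) = g ** orthonormalize A"
proof -
  have "gram_schmidt (\<lambda>k. column k (g ** A)) j = g *v gram_schmidt (\<lambda>k. column k A) j" for j
  proof -
    have "column k (g ** A) = g *v column k A" for k
      by (simp add: vec_eq_iff column_def matrix_matrix_mult_def matrix_vector_mult_def)
    then show ?thesis
      using gram_schmidt_linear_isometry[of "(*v) g" "\<lambda>k. column k A" j]
      by (simp add: orthogonal_matrix_mult_vec_inner assms)
  qed
  then show ?thesis
    by (simp add: vec_eq_iff orthonormalize_def matrix_matrix_mult_def matrix_vector_mult_def)
qed

lemma borel_measurable_component [measurable (raw)]: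
  fixes f :: "'a \<Rightarrow> ('b::euclidean_space) ^ 'n"
  assumes "f \<in> borel_measurable M" shows "(\<lambda>x. f x $ i) \<in> borel_measurable M"
  by (rule measurable_compose[OF assms borel_measurable_continuous_onI]) (intro continuous_intros)

lemma borel_measurable_vec_lambda [measurable (raw)]:
  fixes f :: "'n::finite \<Rightarrow> 'a \<Rightarrow> 'b::euclidean_space"
  assumes "\<And>i. f i \<in> borel_measurable M" shows "(\<lambda>x. \<chi> i. f i x) \<in> borel_measurable M"
  by (subst borel_measurable_euclidean_space)
     (auto simp: Basis_vec_def inner_axis assms intro!: borel_measurable_inner)

lemma borel_measurable_orthonormalize:
  "(orthonormalize :: real ^ 'd ^ 'd \<Rightarrow> _) \<in> borel_measurable borel"
proof -
  have "(\<lambda>A :: real ^ 'd ^ 'd. gram_schmidt (\<lambda>k. column k A) j) \<in> borel_measurable borel" for j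
  proof (induction "idx j" arbitrary: j rule: less_induct)
    case less
    have [measurable]: "(\<lambda>A :: real ^ 'd ^ 'd. column j A) \<in> borel_measurable borel"
      unfolding column_def by measurable
    note [measurable] = less
    show ?case
      by (subst gram_schmidt.simps)
         (intro measurable_compose[OF _ borel_measurable_sgn] borel_measurable_diff borel_measurable_sum
           borel_measurable_scaleR borel_measurable_inner less \<open>_ \<in> _\<close>; simp)
  qed
  then show ?thesis unfolding orthonormalize_def[abs_def] by measurable
qed

lemma continuous_on_det: "continuous_on S (det :: real ^ 'd ^ 'd \<Rightarrow> real)"
  unfolding det_def[abs_def] by (intro continuous_intros)

text \<open>
  The inner product of two matrices is the sum of the inner products of their columns.
\<close>

lemma orthogonal_transformation_matrix_mult:
  fixes g :: "real ^ 'd ^ 'd"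
  assumes "orthogonal_matrix g" shows "orthogonal_transformation ((**) g :: real ^ 'd ^ 'd \<Rightarrow> _)"
proof -
  have "linear ((**) g :: real ^ 'd ^ 'd \<Rightarrow> _)"
    by (intro linearI) (simp_all add: vec_eq_iff matrix_matrix_mult_def distrib_left sum.distrib
        sum_distrib_left mult.left_commute)
  moreover have "(g ** A) \<bullet> (g ** B) = A \<bullet> B" for A B :: "real ^ 'd ^ 'd"
  proof -
    have c: "(\<chi> i. (g ** A) $ i $ j) = g *v (\<chi> i. A $ i $ j)" for A :: "real ^ 'd ^ 'd" and j
      by (simp add: vec_eq_iff matrix_matrix_mult_def matrix_vector_mult_def)
    have i: "A \<bullet> B = (\<Sum>j\<in>UNIV. (\<chi> i. A $ i $ j) \<bullet> (\<chi> i. B $ i $ j))" for A B :: "real ^ 'd ^ 'd"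
      by (simp add: inner_vec_def) (rule sum.swap)
    show ?thesis
      by (simp add: i[of "g ** A"] i[of A] c orthogonal_matrix_mult_vec_inner assms)
  qed
  ultimately show ?thesis by (simp add: orthogonal_transformation_def)
qed

lemma closed_SO: "closed (SO :: (real ^ 'd ^ 'd) set)"
proof -
  have "SO = {A :: real ^ 'd ^ 'd. (\<forall>i j. (transpose A ** A) $ i $ j = mat 1 $ i $ j) \<and> det A = 1}"
    by (auto simp: SO_iff orthogonal_matrix vec_eq_iff)
  also have "closed \<dots>"
    unfolding matrix_matrix_mult_def transpose_def vec_lambda_beta
    by (intro closed_Collect_conj closed_Collect_all closed_Collect_eq continuous_on_det continuous_intros)
  finally show ?thesis .
qed

lemma compact_SO: "compact (SO :: (real ^ 'd ^ 'd) set)"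
proof -
  have "norm A = norm (mat 1 :: real ^ 'd ^ 'd)" if "A \<in> SO" for A :: "real ^ 'd ^ 'd"
    using orthogonal_transformation_norm[OF orthogonal_transformation_matrix_mult, of A "mat 1"] that
    by (simp add: SO_iff)
  then have "bounded (SO :: (real ^ 'd ^ 'd) set)" by (intro boundedI) auto
  with closed_SO show ?thesis by (simp add: compact_eq_bounded_closed)
qed

text \<open>
  Haar measure is the distribution of the orthonormalisation of a matrix that is uniformly
  distributed on a bounded set of invertible matrices.  This set and Lebesgue measure are invariant
  under left multiplication by rotations, and orthonormalisation is equivariant.
\<close>

lemma ex_haar_SO:
  obtains H :: "(real ^ 'd ^ 'd) measure"
  where "prob_space H" "space H = SO" "sets H = sets (restrict_space borel SO)"
    "\<And>g. g \<in> SO \<Longrightarrow> (**) g \<in> measurable H H"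
    "\<And>g. g \<in> SO \<Longrightarrow> distr H H ((**) g) = H"
proof -
  define R where "R = norm (mat 1 :: real ^ 'd ^ 'd) + 1"
  define E where "E = ball 0 R \<inter> {A :: real ^ 'd ^ 'd. det A \<noteq> 0}"
  define U where "U = uniform_measure lborel E"
  fix k :: 'd
  \<comment> \<open>Multiplication by \<open>D\<close> from the right repairs a determinant \<open>-1\<close> and commutes with left translations.\<close>
  define D where "D = householder (axis k 1 :: real ^ 'd)"
  have D: "orthogonal_matrix D" "det D = - 1"
    by (auto simp: D_def orthogonal_householder det_householder axis_eq_0_iff)
  define S where "S A = (if det A = 0 then mat 1 else if det (orthonormalize A) = 1 then orthonormalize A
    else orthonormalize A ** D)" for A :: "real ^ 'd ^ 'd"
  define H where "H = distr U (restrict_space borel SO) S"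
  have "open E" unfolding E_def
    by (intro open_Int open_ball open_Collect_neq continuous_on_det continuous_intros)
  moreover have "mat 1 \<in> E" by (simp add: E_def R_def)
  ultimately obtain e where e: "e > 0" "ball (mat 1) e \<subseteq> E" by (auto simp: open_contains_ball)
  have [measurable]: "E \<in> sets borel" using \<open>open E\<close> by simp
  have Epos: "emeasure lborel E \<noteq> 0"
  proof
    assume "emeasure lborel E = 0"
    then have "emeasure lborel (ball (mat 1 :: real ^ 'd ^ 'd) e) = 0"
      using emeasure_mono[OF e(2), of lborel] by simp
    then show False
      using content_ball_gt_0_iff[of "mat 1 :: real ^ 'd ^ 'd" e] e(1) by (simp add: measure_def)
  qed
  have Efin: "emeasure lborel E \<noteq> \<infinity>"
    using emeasure_bounded_finite[of E] bounded_subset[OF bounded_ball, of E 0 R] by (auto simp: E_def)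
  have U: "prob_space U" unfolding U_def by (rule prob_space_uniform_measure[OF Epos Efin])
  have setsU[measurable_cong]: "sets U = sets borel" by (simp add: U_def)
  have [measurable]: "(det :: real ^ 'd ^ 'd \<Rightarrow> real) \<in> borel_measurable borel"
    by (intro borel_measurable_continuous_onI continuous_on_det)
  note [measurable] = borel_measurable_orthonormalize
  have [measurable]: "(\<lambda>A. A ** D) \<in> borel_measurable borel"
    unfolding matrix_matrix_mult_def by measurable
  have [measurable]: "(\<lambda>A :: real ^ 'd ^ 'd. g ** A) \<in> borel_measurable borel" for g :: "real ^ 'd ^ 'd"
    unfolding matrix_matrix_mult_def by measurable
  have Sb[measurable]: "S \<in> borel_measurable borel" unfolding S_def[abs_def] by measurable
  have S_SO: "S A \<in> SO" for A
  proof (cases "det A = 0")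
    case False
    then have "orthogonal_matrix (orthonormalize A)" by (rule orthogonal_orthonormalize)
    with D show ?thesis
      using det_orthogonal_matrix[of "orthonormalize A"]
      by (auto simp: S_def SO_iff orthogonal_matrix_mul det_mul orthogonal_matrix_id)
  qed (simp add: S_def SO_one)
  have S[measurable]: "S \<in> measurable U (restrict_space borel SO)"
    by (intro measurable_restrict_space2) (use S_SO in auto)
  have equiv: "S (g ** A) = g ** S A" if "g \<in> SO" "det A \<noteq> 0" for g A
    using that by (auto simp: S_def SO_iff det_mul orthonormalize_mult matrix_mul_assoc)
  have U_inv: "distr U borel ((**) g) = U" if g: "g \<in> SO" for g
  proof (rule measure_eqI)
    have o: "orthogonal_transformation ((**) g :: real ^ 'd ^ 'd \<Rightarrow> _)"
      using g by (simp add: SO_iff orthogonal_transformation_matrix_mult)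
    fix B assume "B \<in> sets (distr U borel ((**) g))"
    then have [measurable]: "B \<in> sets borel" by simp
    have gB: "((**) g) -` B \<in> sets borel"
      by (rule measurable_sets_borel[of "(**) g" borel]) measurable
    have "((**) g) -` E = E"
      using g by (auto simp: E_def orthogonal_transformation_norm[OF o] det_mul SO_iff)
    then have "E \<inter> ((**) g) -` B = ((**) g) -` (E \<inter> B)" by auto
    then have "emeasure (distr U borel ((**) g)) B
        = emeasure (distr lborel borel ((**) g)) (E \<inter> B) / emeasure lborel E"
      by (simp add: emeasure_distr U_def gB)
    then show "emeasure (distr U borel ((**) g)) B = emeasure U B"
      by (simp add: lborel_orthogonal_invariant[OF o] U_def)
  qed (simp add: setsU)
  show ?thesis
  proof (rule that[of H])
    show "prob_space H" unfolding H_def by (rule prob_space.prob_space_distr[OF U S])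
    show "space H = SO" by (simp add: H_def space_restrict_space)
    show setsH: "sets H = sets (restrict_space borel SO)" by (simp add: H_def)
    fix g :: "real ^ 'd ^ 'd" assume g: "g \<in> SO"
    have mg: "(**) g \<in> measurable (restrict_space borel SO) (restrict_space borel SO)"
      by (intro measurable_restrict_space2 measurable_restrict_space1)
         (use g SO_mult in \<open>auto simp: space_restrict_space\<close>)
    then show "(**) g \<in> measurable H H" using measurable_cong_sets[OF setsH setsH] by blast
    have "distr H H ((**) g) = distr U (restrict_space borel SO) (\<lambda>A. g ** S A)"
      unfolding H_def by (subst distr_distr) (auto simp: o_def mg intro!: distr_cong)
    also have "\<dots> = distr U (restrict_space borel SO) (\<lambda>A. S (g ** A))"
    proof (rule distr_cong_AE)
      show "AE A in U. g ** S A = S (g ** A)"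
        unfolding U_def by (rule AE_uniform_measureI) (auto simp: E_def equiv g)
      show "(\<lambda>A. g ** S A) \<in> measurable U (restrict_space borel SO)"
        by (rule measurable_compose[OF S mg])
      show "(\<lambda>A. S (g ** A)) \<in> measurable U (restrict_space borel SO)"
        by (intro measurable_restrict_space2) (use S_SO in auto)
    qed simp_all
    also have "\<dots> = distr (distr U borel ((**) g)) (restrict_space borel SO) S"
    proof (subst distr_distr)
      show "S \<in> measurable borel (restrict_space borel SO)"
        by (intro measurable_restrict_space2) (use S_SO in auto)
    qed (simp_all add: o_def)
    also have "\<dots> = H" by (simp add: U_inv[OF g] H_def)
    finally show "distr H H ((**) g) = H" .
  qed
qed

section \<open>Powers of the rotation group\<close>

abbreviation tuple_mult :: "nat set \<Rightarrow> (nat \<Rightarrow> real ^ 'd ^ 'd) \<Rightarrow> (nat \<Rightarrow> real ^ 'd ^ 'd) \<Rightarrow> nat \<Rightarrow> real ^ 'd ^ 'd"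
  where "tuple_mult I g x \<equiv> (\<lambda>i\<in>I. g i ** x i)"

lemma SO_power_simps:
  "carrier (SO_power I) = SO_tuples I" "mult (SO_power I) = tuple_mult I"
  by (simp_all add: SO_power_def SO_tuples_def SO_group_def product_group_def)

lemma topspace_SO_power_top [simp]: "topspace (SO_power_top I) = SO_tuples I"
  by (simp add: SO_power_top_def SO_tuples_def)

lemma SO_tuplesD: "x \<in> SO_tuples I \<Longrightarrow> i \<in> I \<Longrightarrow> x i \<in> SO"
  by (auto simp: SO_tuples_def)

lemma tuple_mult_closed: "g \<in> SO_tuples I \<Longrightarrow> x \<in> SO_tuples I \<Longrightarrow> tuple_mult I g x \<in> SO_tuples I"
  by (auto simp: SO_tuples_def intro!: SO_mult)

lemma tuple_mult_assoc: "tuple_mult I (tuple_mult I g h) x = tuple_mult I g (tuple_mult I h x)"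
  by (auto simp: fun_eq_iff matrix_mul_assoc)

lemma continuous_map_coordinate:
  "i \<in> I \<Longrightarrow> continuous_map (SO_power_top I) (top_of_set SO) (\<lambda>x. x i)"
  unfolding SO_power_top_def by (rule continuous_map_product_projection)

lemma continuous_map_tuple_mult:
  assumes g: "g \<in> SO_tuples I"
  shows "continuous_map (SO_power_top I) (SO_power_top I) (tuple_mult I g)"
proof -
  have "continuous_map (SO_power_top I) (top_of_set SO) (\<lambda>x. g i ** x i)" if "i \<in> I" for i
  proof -
    have "continuous_on SO ((**) (g i))"
      unfolding matrix_matrix_mult_def by (intro continuous_intros)
    then have "continuous_map (top_of_set SO) (top_of_set SO) ((**) (g i))"
      using SO_tuplesD[OF g that] by (auto intro: SO_mult)
    from continuous_map_compose[OF continuous_map_coordinate[OF that] this]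
    show ?thesis by (simp add: o_def)
  qed
  then show ?thesis
    unfolding SO_power_top_def[of I]
    by (intro continuous_map_componentwise[THEN iffD2] conjI ballI) (auto cong: if_cong)
qed

lemma compact_SO_power_top: "compact_space (SO_power_top I :: (nat \<Rightarrow> real ^ 'd ^ 'd) topology)"
  unfolding SO_power_top_def
  by (simp add: compact_space_product_topology compact_space_subtopology compact_SO)

text \<open>
  A form of compactness that will be used twice: a nonempty open set cannot be null, and a zero set
  that is almost invariant under finitely many translations must be null.
\<close>

lemma finite_translates_cover:
  fixes U :: "(nat \<Rightarrow> real ^ 'd ^ 'd) set"
  assumes "openin (SO_power_top I) U" "U \<noteq> {}"
  obtains K where "finite K" "K \<subseteq> SO_tuples I"
    "\<And>x. x \<in> SO_tuples I \<Longrightarrow> \<exists>g\<in>K. tuple_mult I g x \<in> U"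
proof -
  obtain y where y: "y \<in> U" "y \<in> SO_tuples I"
    using assms openin_subset by fastforce
  let ?V = "\<lambda>g. {x \<in> SO_tuples I. tuple_mult I g x \<in> U}"
  have "openin (SO_power_top I) (?V g)" if "g \<in> SO_tuples I" for g
    using openin_continuous_map_preimage[OF continuous_map_tuple_mult[OF that] assms(1)] by simp
  moreover have "topspace (SO_power_top I) \<subseteq> \<Union> (?V ` SO_tuples I)"
  proof
    fix x :: "nat \<Rightarrow> real ^ 'd ^ 'd" assume "x \<in> topspace (SO_power_top I)"
    then have x: "x \<in> SO_tuples I" by simp
    let ?g = "\<lambda>i\<in>I. y i ** transpose (x i)"
    have g: "?g \<in> SO_tuples I"
      using x y by (auto simp: SO_tuples_def intro!: SO_mult SO_transpose)
    have "tuple_mult I ?g x = y"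
    proof
      fix i show "tuple_mult I ?g x i = y i"
        using x y SO_transpose_mult(1)[OF SO_tuplesD[OF x]]
        by (auto simp: SO_tuples_def PiE_def extensional_def matrix_mul_assoc[symmetric])
    qed
    with x y g show "x \<in> \<Union> (?V ` SO_tuples I)" by (intro UN_I[OF g]) auto
  qed
  ultimately have "\<exists>\<F>. finite \<F> \<and> \<F> \<subseteq> ?V ` SO_tuples I \<and> topspace (SO_power_top I) \<subseteq> \<Union> \<F>"
    by (intro compact_SO_power_top[unfolded compact_space_alt, rule_format] conjI ballI) auto
  then obtain \<F> where F: "finite \<F>" "\<F> \<subseteq> ?V ` SO_tuples I" "SO_tuples I \<subseteq> \<Union> \<F>"
    by auto
  from finite_subset_image[OF F(1,2)] obtain K where
    "finite K" "K \<subseteq> SO_tuples I" "\<F> = ?V ` K" by blast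
  with F(3) have "finite K" "K \<subseteq> SO_tuples I" "SO_tuples I \<subseteq> \<Union> (?V ` K)" by auto
  then show ?thesis by (intro that[of K]) auto
qed

section \<open>Haar measure on powers of the rotation group\<close>

text \<open>
  By second countability, an open set of the product topology is a countable union of open
  boxes; this makes the product measure a measure on the Borel sets.
\<close>

lemma open_in_sets_PiM:
  fixes S :: "'b::second_countable_topology set"
  assumes "finite I" and U: "openin (product_topology (\<lambda>_. top_of_set S) I) U"
  shows "U \<in> sets (\<Pi>\<^sub>M i\<in>I. restrict_space borel S)"
proof -
  obtain B :: "'b set set" where B: "countable B" "topological_basis B"
    using ex_countable_basis by auto
  let ?box = "\<lambda>b. \<Pi>\<^sub>E i\<in>I. S \<inter> b i"
  let ?C = "{b \<in> (\<Pi>\<^sub>E i\<in>I. B). ?box b \<subseteq> U}"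
  have "U \<subseteq> \<Union> (?box ` ?C)"
  proof
    fix x assume x: "x \<in> U"
    then obtain W where W: "\<And>i. i \<in> I \<Longrightarrow> openin (top_of_set S) (W i)" "x \<in> Pi\<^sub>E I W" "Pi\<^sub>E I W \<subseteq> U"
      using U unfolding openin_product_topology_alt by metis
    have "\<exists>b\<in>B. x i \<in> b \<and> S \<inter> b \<subseteq> W i" if i: "i \<in> I" for i
    proof -
      obtain V where V: "open V" "W i = S \<inter> V" using W(1)[OF i] by (auto simp: openin_open)
      then have "x i \<in> V" using W(2) i by auto
      then obtain b where "b \<in> B" "x i \<in> b" "b \<subseteq> V" using topological_basisE[OF B(2) V(1)] by metis
      then show ?thesis using V(2) by blast
    qed
    then obtain b where b: "\<And>i. i \<in> I \<Longrightarrow> b i \<in> B \<and> x i \<in> b i \<and> S \<inter> b i \<subseteq> W i" by metis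
    have xS: "x \<in> (\<Pi>\<^sub>E i\<in>I. S)" using x openin_subset[OF U] by auto
    have "?box (restrict b I) \<subseteq> Pi\<^sub>E I W" using b by (intro PiE_mono) auto
    then have "restrict b I \<in> ?C" using b W(3) by auto
    moreover have "x \<in> ?box (restrict b I)" using b xS by auto
    ultimately show "x \<in> \<Union> (?box ` ?C)" by blast
  qed
  then have U_eq: "U = \<Union> (?box ` ?C)" by auto
  have "countable ?C"
    by (rule countable_subset[OF _ countable_PiE[OF \<open>finite I\<close>, of "\<lambda>_. B"]]) (use B in auto)
  moreover have "?box b \<in> sets (\<Pi>\<^sub>M i\<in>I. restrict_space borel S)" if "b \<in> ?C" for b
  proof (rule sets_PiM_I_finite[OF \<open>finite I\<close>])
    fix i assume "i \<in> I"
    then have "open (b i)" using that topological_basis_open[OF B(2)] by auto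
    then show "S \<inter> b i \<in> sets (restrict_space borel S)" by (auto simp: sets_restrict_space)
  qed
  ultimately show ?thesis by (subst U_eq) (intro sets.countable_UN'')
qed

definition open_algebra :: "'a topology \<Rightarrow> 'a measure" where
  "open_algebra T = sigma (topspace T) {U. openin T U}"

lemma space_open_algebra [simp]: "space (open_algebra T) = topspace T"
  by (simp add: open_algebra_def space_measure_of_conv)

lemma sets_open_algebra: "sets (open_algebra T) = sigma_sets (topspace T) {U. openin T U}"
  unfolding open_algebra_def by (rule sets_measure_of) (auto dest: openin_subset)

lemma measurable_open_algebra:
  assumes "f \<in> space M \<rightarrow> topspace T" "\<And>U. openin T U \<Longrightarrow> f -` U \<inter> space M \<in> sets M"
  shows "f \<in> measurable M (open_algebra T)"
  unfolding open_algebra_def using assms by (intro measurable_measure_of) (auto dest: openin_subset)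

lemma continuous_map_measurable:
  assumes "continuous_map X Y f" shows "f \<in> measurable (open_algebra X) (open_algebra Y)"
proof (rule measurable_open_algebra)
  show "f \<in> space (open_algebra X) \<rightarrow> topspace Y"
    using assms by (auto simp: continuous_map_def)
  fix U assume "openin Y U"
  then have "openin X {x \<in> topspace X. f x \<in> U}" by (rule openin_continuous_map_preimage[OF assms])
  moreover have "f -` U \<inter> space (open_algebra X) = {x \<in> topspace X. f x \<in> U}" by auto
  ultimately show "f -` U \<inter> space (open_algebra X) \<in> sets (open_algebra X)"
    by (auto simp: sets_open_algebra)
qed

lemma tuple_mult_image:
  assumes g: "g \<in> SO_tuples I" and B: "B \<subseteq> SO_tuples I"
  shows "tuple_mult I g ` B = tuple_mult I (\<lambda>i\<in>I. transpose (g i)) -` B \<inter> SO_tuples I"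
proof -
  have inv: "tuple_mult I (\<lambda>i\<in>I. transpose (g i)) (tuple_mult I g x) = x"
       "tuple_mult I g (tuple_mult I (\<lambda>i\<in>I. transpose (g i)) x) = x" if "x \<in> SO_tuples I" for x
    using that SO_transpose_mult[OF SO_tuplesD[OF g]]
    by (auto simp: fun_eq_iff SO_tuples_def PiE_def extensional_def matrix_mul_assoc)
  show ?thesis
  proof (intro equalityI subsetI)
    fix y assume "y \<in> tuple_mult I g ` B"
    then obtain x where x: "x \<in> B" "y = tuple_mult I g x" by blast
    have "y \<in> SO_tuples I" unfolding x(2) using x(1) B by (intro tuple_mult_closed[OF g]) auto
    moreover have "tuple_mult I (\<lambda>i\<in>I. transpose (g i)) y = x" unfolding x(2) using x(1) B by (intro inv) auto
    ultimately show "y \<in> tuple_mult I (\<lambda>i\<in>I. transpose (g i)) -` B \<inter> SO_tuples I"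
      using x(1) by (simp only: vimage_eq Int_iff)
  next
    fix y assume y: "y \<in> tuple_mult I (\<lambda>i\<in>I. transpose (g i)) -` B \<inter> SO_tuples I"
    then have "y = tuple_mult I g (tuple_mult I (\<lambda>i\<in>I. transpose (g i)) y)" by (simp only: inv(2) Int_iff)
    then show "y \<in> tuple_mult I g ` B" using y by blast
  qed
qed

text \<open>
  Haar measure on the power is the product measure, moved to the Borel sets along the identity map.
  Its invariance is also recorded as an equality of image measures, which is the form in which it
  is applied.
\<close>

lemma ex_haar_SO_power:
  assumes "finite I"
  obtains M :: "(nat \<Rightarrow> real ^ 'd ^ 'd) measure"
  where "haar_probability (SO_power I) (SO_power_top I) M" "sets M = sets (open_algebra (SO_power_top I))"
    "\<And>g. g \<in> SO_tuples I \<Longrightarrow> distr M M (tuple_mult I g) = M"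
proof -
  obtain H :: "(real ^ 'd ^ 'd) measure" where H: "prob_space H" "space H = SO"
    "sets H = sets (restrict_space borel SO)"
    "\<And>g. g \<in> SO \<Longrightarrow> (**) g \<in> measurable H H"
    "\<And>g. g \<in> SO \<Longrightarrow> distr H H ((**) g) = H"
    using ex_haar_SO by blast
  interpret H: prob_space H by (rule H(1))
  interpret P: finite_product_prob_space "\<lambda>_. H" I by standard (rule assms)
  let ?P = "Pi\<^sub>M I (\<lambda>_. H)" and ?T = "SO_power_top I :: (nat \<Rightarrow> real ^ 'd ^ 'd) topology"
  have spaceP: "space ?P = SO_tuples I" by (simp add: space_PiM H(2) SO_tuples_def)
  have setsP: "sets ?P = sets (\<Pi>\<^sub>M i\<in>I. restrict_space borel SO)" by (rule sets_PiM_cong) (auto simp: H(3))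
  define M where "M = distr ?P (open_algebra ?T) (\<lambda>x. x)"
  have id: "(\<lambda>x. x) \<in> measurable ?P (open_algebra ?T)"
  proof (rule measurable_open_algebra)
    fix U assume U: "openin ?T U"
    then have "U \<subseteq> space ?P" using openin_subset spaceP by fastforce
    moreover have "U \<in> sets ?P"
      unfolding setsP by (rule open_in_sets_PiM[OF assms U[unfolded SO_power_top_def]])
    ultimately show "(\<lambda>x. x) -` U \<inter> space ?P \<in> sets ?P" by (simp add: Int_absorb2)
  qed (simp add: spaceP)
  have spaceM: "space M = SO_tuples I" and setsM: "sets M = sets (open_algebra ?T)"
    by (simp_all add: M_def)
  have pM: "prob_space M" unfolding M_def by (rule P.prob_space_distr[OF id])
  have mP: "tuple_mult I g \<in> measurable ?P ?P" if "g \<in> SO_tuples I" for g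
    using H(4)[OF SO_tuplesD[OF that]] by (intro measurable_restrict) (auto intro: measurable_compose[OF measurable_component_singleton])
  have P_inv: "distr ?P ?P (tuple_mult I g) = ?P" if g: "g \<in> SO_tuples I" for g
  proof (rule P.PiM_eqI)
    show "finite I" by fact
    fix A assume A: "\<And>i. i \<in> I \<Longrightarrow> A i \<in> sets H"
    have "tuple_mult I g -` (Pi\<^sub>E I A) \<inter> space ?P = (\<Pi>\<^sub>E i\<in>I. (**) (g i) -` A i \<inter> space H)"
      by (auto simp: space_PiM PiE_iff)
    moreover have "(**) (g i) -` A i \<inter> space H \<in> sets H" if "i \<in> I" for i
      using measurable_sets[OF H(4) A] SO_tuplesD[OF g] that by blast
    ultimately have "emeasure (distr ?P ?P (tuple_mult I g)) (Pi\<^sub>E I A)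
        = (\<Prod>i\<in>I. emeasure H ((**) (g i) -` A i \<inter> space H))"
      using A assms by (simp add: emeasure_distr mP g sets_PiM_I_finite P.emeasure_PiM)
    also have "\<dots> = (\<Prod>i\<in>I. emeasure H (A i))"
    proof (rule prod.cong[OF refl])
      fix i assume i: "i \<in> I"
      show "emeasure H ((**) (g i) -` A i \<inter> space H) = emeasure H (A i)"
        using emeasure_distr[OF H(4) A, of "g i" i] H(5)[of "g i"] SO_tuplesD[OF g i] i by simp
    qed
    finally show "emeasure (distr ?P ?P (tuple_mult I g)) (Pi\<^sub>E I A) = (\<Prod>i\<in>I. emeasure H (A i))" .
  qed simp
  have mM: "tuple_mult I g \<in> measurable M M" if "g \<in> SO_tuples I" for g
    using continuous_map_measurable[OF continuous_map_tuple_mult[OF that]] measurable_cong_sets[OF setsM setsM] by blast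
  have M_inv: "distr M M (tuple_mult I g) = M" if g: "g \<in> SO_tuples I" for g
  proof -
    have m: "tuple_mult I g \<in> measurable (open_algebra ?T) M"
      using mM[OF g] measurable_cong_sets[OF setsM refl] by blast
    have "distr M M (tuple_mult I g) = distr ?P M (tuple_mult I g)"
      unfolding M_def by (subst distr_distr) (use id m in \<open>auto simp: o_def M_def\<close>)
    also have "\<dots> = distr (distr ?P ?P (tuple_mult I g)) (open_algebra ?T) (\<lambda>x. x)"
      by (subst distr_distr) (auto simp: id mP g o_def setsM intro: distr_cong)
    also have "\<dots> = M" by (simp only: P_inv[OF g] M_def)
    finally show ?thesis .
  qed
  have "haar_probability (SO_power I) ?T M"
    unfolding haar_probability_def SO_power_simps
  proof (intro conjI ballI)
    fix g :: "nat \<Rightarrow> real ^ 'd ^ 'd" and B assume g: "g \<in> SO_tuples I" and B: "B \<in> sets M"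
    let ?h = "\<lambda>i\<in>I. transpose (g i)"
    have h: "?h \<in> SO_tuples I" using g by (auto simp: SO_tuples_def intro: SO_transpose)
    have "tuple_mult I g ` B = tuple_mult I ?h -` B \<inter> space M"
      unfolding spaceM by (rule tuple_mult_image[OF g]) (use sets.sets_into_space[OF B] spaceM in simp)
    then have "emeasure M (tuple_mult I g ` B) = emeasure (distr M M (tuple_mult I ?h)) B"
      by (simp only: emeasure_distr[OF mM[OF h] B])
    then show "emeasure M (tuple_mult I g ` B) = emeasure M B" by (simp only: M_inv[OF h])
  qed (simp_all add: pM spaceM setsM sets_open_algebra)
  with setsM M_inv show ?thesis by (intro that[of M]) auto
qed

section \<open>Zero sets of polynomials in the matrix entries\<close>

text \<open>
  Polynomial functions of the matrix entries of the coordinates in \<open>I\<close>, given by their closure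
  properties: all that matters is that they are continuous on \<open>SO(d)\<^sup>I\<close> and become rational
  functions along the curves considered below.
\<close>

inductive entry_poly :: "nat set \<Rightarrow> ((nat \<Rightarrow> real ^ 'd ^ 'd) \<Rightarrow> real) \<Rightarrow> bool" for I where
  const: "entry_poly I (\<lambda>_. c)"
| entry: "i \<in> I \<Longrightarrow> entry_poly I (\<lambda>x. x i $ a $ b)"
| add: "entry_poly I F \<Longrightarrow> entry_poly I G \<Longrightarrow> entry_poly I (\<lambda>x. F x + G x)"
| mult: "entry_poly I F \<Longrightarrow> entry_poly I G \<Longrightarrow> entry_poly I (\<lambda>x. F x * G x)"

lemma entry_poly_sum: "(\<And>a. a \<in> A \<Longrightarrow> entry_poly I (F a)) \<Longrightarrow> entry_poly I (\<lambda>x. \<Sum>a\<in>A. F a x)"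
  by (induction A rule: infinite_finite_induct) (auto intro: entry_poly.intros)

lemma entry_poly_prod: "(\<And>a. a \<in> A \<Longrightarrow> entry_poly I (F a)) \<Longrightarrow> entry_poly I (\<lambda>x. \<Prod>a\<in>A. F a x)"
  by (induction A rule: infinite_finite_induct) (auto intro: entry_poly.intros)

lemma entry_poly_continuous:
  fixes F :: "(nat \<Rightarrow> real ^ 'd ^ 'd) \<Rightarrow> real"
  assumes "entry_poly I F"
  shows "continuous_map (SO_power_top I) euclideanreal F"
  using assms
proof induction
  case (entry i a b)
  have "continuous_map (top_of_set SO) euclideanreal (\<lambda>A :: real ^ 'd ^ 'd. A $ a $ b)"
    by (simp, intro continuous_intros)
  from continuous_map_compose[OF continuous_map_coordinate[OF entry] this]
  show ?case by (simp add: o_def)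
qed (auto intro: continuous_map_add continuous_map_real_mult)

definition segment_point :: "real ^ 'd \<Rightarrow> real ^ 'd \<Rightarrow> real \<Rightarrow> real ^ 'd" where
  "segment_point u v t = (1 - t) *\<^sub>R u + t *\<^sub>R v"

lemma segment_norm_poly: "\<exists>D. \<forall>t. poly D t = segment_point u v t \<bullet> segment_point u v t"
proof -
  have "u \<bullet> u + t * (2 * (u \<bullet> v) - 2 * (u \<bullet> u)) + t * t * (u \<bullet> u - 2 * (u \<bullet> v) + v \<bullet> v)
      = segment_point u v t \<bullet> segment_point u v t" for t
    by (simp add: segment_point_def inner_add_left inner_add_right inner_commute[of v u] algebra_simps)
  then show ?thesis
    by (intro exI[of _ "[:u \<bullet> u, 2 * (u \<bullet> v) - 2 * (u \<bullet> u), u \<bullet> u - 2 * (u \<bullet> v) + v \<bullet> v:]"])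
      (simp add: algebra_simps)
qed

lemma householder_mult_entry:
  "(householder z ** A) $ a $ b = A $ a $ b - 2 * z $ a / (z \<bullet> z) * (\<Sum>k\<in>UNIV. z $ k * A $ k $ b)"
proof -
  have "(householder z ** A) $ a $ b = (householder z *v column b A) $ a"
    by (simp add: matrix_matrix_mult_def matrix_vector_mult_def column_def)
  also have "\<dots> = A $ a $ b - 2 * (z \<bullet> column b A) / (z \<bullet> z) * z $ a"
    by (simp add: householder_mult_vec column_def)
  also have "z \<bullet> column b A = (\<Sum>k\<in>UNIV. z $ k * A $ k $ b)"
    by (simp add: inner_vec_def column_def)
  finally show ?thesis by (simp add: mult.commute)
qed

text \<open>
  The entries of a reflection along \<open>w\<close> are quadratic polynomials in \<open>w\<close> divided by \<open>w \<bullet> w\<close>, and here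
  \<open>w\<close> depends linearly on the parameter \<open>t\<close>.
\<close>

lemma entry_poly_along_segment:
  fixes u v :: "real ^ 'd"
  assumes "entry_poly I F"
  shows "\<exists>p n. \<forall>t. segment_point u v t \<noteq> 0 \<longrightarrow>
    F (x(i := householder (segment_point u v t) ** A)) *
      (segment_point u v t \<bullet> segment_point u v t) ^ n = poly p t"
proof -
  let ?w = "segment_point u v"
  define y where "y t = x(i := householder (?w t) ** A)" for t
  obtain D where D: "poly D t = ?w t \<bullet> ?w t" for t
    using segment_norm_poly by blast
  have "\<exists>p n. \<forall>t. ?w t \<noteq> 0 \<longrightarrow> F (y t) * (?w t \<bullet> ?w t) ^ n = poly p t"
    using assms
  proof induction
    case (const c)
    show ?case by (rule exI[of _ "[:c:]"], rule exI[of _ 0]) simp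
  next
    case (entry j a b)
    show ?case
    proof (cases "j = i")
      case True
      define w where "w k = [:u $ k, v $ k - u $ k:]" for k
      have w: "poly (w k) t = ?w t $ k" for k t
        by (simp add: w_def segment_point_def algebra_simps)
      define p where "p = smult (A $ a $ b) D - smult 2 (w a * (\<Sum>k\<in>UNIV. smult (A $ k $ b) (w k)))"
      have "y t j $ a $ b * (?w t \<bullet> ?w t) ^ 1 = poly p t" if "?w t \<noteq> 0" for t
      proof -
        have "?w t \<bullet> ?w t \<noteq> 0" using that by simp
        then show ?thesis
          by (simp add: True y_def p_def D poly_sum w householder_mult_entry field_simps
              del: inner_eq_zero_iff)
      qed
      then show ?thesis by blast
    next
      case False
      then show ?thesis by (intro exI[of _ "[:x j $ a $ b:]"] exI[of _ 0]) (simp add: y_def)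
    qed
  next
    case (add F G)
    then obtain p m q n where
      p: "\<And>t. ?w t \<noteq> 0 \<Longrightarrow> poly p t = F (y t) * (?w t \<bullet> ?w t) ^ m" and
      q: "\<And>t. ?w t \<noteq> 0 \<Longrightarrow> poly q t = G (y t) * (?w t \<bullet> ?w t) ^ n" by metis
    have "(F (y t) + G (y t)) * (?w t \<bullet> ?w t) ^ (m + n) = poly (p * D ^ n + q * D ^ m) t"
      if "?w t \<noteq> 0" for t
      unfolding poly_add poly_mult poly_power D p[OF that] q[OF that] power_add
      by (simp only: distrib_right mult.assoc mult.commute[of "(?w t \<bullet> ?w t) ^ m"])
    then show ?case by blast
  next
    case (mult F G)
    then obtain p m q n where
      p: "\<And>t. ?w t \<noteq> 0 \<Longrightarrow> poly p t = F (y t) * (?w t \<bullet> ?w t) ^ m" and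
      q: "\<And>t. ?w t \<noteq> 0 \<Longrightarrow> poly q t = G (y t) * (?w t \<bullet> ?w t) ^ n" by metis
    have "F (y t) * G (y t) * (?w t \<bullet> ?w t) ^ (m + n) = poly (p * q) t" if "?w t \<noteq> 0" for t
      unfolding poly_mult p[OF that] q[OF that] power_add by (simp only: mult_ac)
    then show ?case by blast
  qed
  then show ?thesis by (simp only: y_def)
qed

lemma householder_scale: "c \<noteq> 0 \<Longrightarrow> householder (c *\<^sub>R u) = householder u"
  by (simp add: vec_eq_iff householder_def)

text \<open>
  The segment avoids the origin, where the reflection degenerates, unless both end points span the
  same line.
\<close>

lemma householder_segment_degenerate:
  assumes "u \<noteq> 0" "v \<noteq> 0" and "segment_point u v t = 0"
  shows "householder u = householder v"
proof -
  have eq: "(1 - t) *\<^sub>R u = (- t) *\<^sub>R v"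
    unfolding scaleR_minus_left
    by (rule eq_neg_iff_add_eq_0[THEN iffD2]) (rule assms(3)[unfolded segment_point_def])
  have t: "t \<noteq> 0" "1 - t \<noteq> 0"
  proof -
    show "t \<noteq> 0"
    proof
      assume "t = 0" with eq have "u = 0" by simp
      with assms(1) show False ..
    qed
    show "1 - t \<noteq> 0"
    proof
      assume "1 - t = 0"
      with eq have "0 = - t *\<^sub>R v" by (simp only: scaleR_zero_left)
      with \<open>t \<noteq> 0\<close> assms(2) show False by simp
    qed
  qed
  have "householder u = householder ((1 - t) *\<^sub>R u)"
    by (rule householder_scale[OF t(2), symmetric])
  also have "\<dots> = householder ((- t) *\<^sub>R v)" by (rule arg_cong[OF eq])
  also have "\<dots> = householder v"
    by (rule householder_scale) (use t(1) in simp)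
  finally show ?thesis .
qed

text \<open>
  The properties of Haar measure on \<open>SO(d)\<^sup>I\<close> that the argument about zero sets relies on.
\<close>

locale haar_power = prob_space M for M :: "(nat \<Rightarrow> real ^ 'd ^ 'd) measure" +
  fixes I :: "nat set"
  assumes finI: "finite I"
    and haar: "haar_probability (SO_power I) (SO_power_top I) M"
    and sets_M: "sets M = sets (open_algebra (SO_power_top I))"
    and invariant: "g \<in> SO_tuples I \<Longrightarrow> distr M M (tuple_mult I g) = M"
begin

lemma space_M: "space M = SO_tuples I"
proof -
  from haar have "space M = topspace (SO_power_top I)"
    unfolding haar_probability_def by (elim conjE)
  then show ?thesis by simp
qed

lemma measurable_tuple_mult: "g \<in> SO_tuples I \<Longrightarrow> tuple_mult I g \<in> measurable M M"
  using continuous_map_measurable[OF continuous_map_tuple_mult[of g I]]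
    measurable_cong_sets[OF sets_M sets_M] by blast

lemma openin_measurable: "openin (SO_power_top I) U \<Longrightarrow> U \<in> sets M"
  by (simp add: sets_M sets_open_algebra)

lemma AE_tuple_mult:
  assumes "g \<in> SO_tuples I" "AE x in M. P x"
  shows "AE x in M. P (tuple_mult I g x)"
  by (rule AE_distrD[OF measurable_tuple_mult[OF assms(1)]])
     (simp only: invariant[OF assms(1)] assms(2))

lemma open_not_null:
  assumes "openin (SO_power_top I) U" "U \<noteq> {}"
  shows "\<not> (AE x in M. x \<notin> U)"
proof
  assume "AE x in M. x \<notin> U"
  obtain K where K: "finite K" "K \<subseteq> SO_tuples I"
    "\<And>x. x \<in> SO_tuples I \<Longrightarrow> \<exists>g\<in>K. tuple_mult I g x \<in> U"
    using finite_translates_cover[OF assms] by blast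
  have "AE x in M. \<forall>g\<in>K. tuple_mult I g x \<notin> U"
    using K(2) AE_tuple_mult[OF _ \<open>AE x in M. x \<notin> U\<close>] by (intro AE_finite_allI K(1)) auto
  then have "AE x in M. False"
  proof (rule AE_mp, intro AE_I2 impI)
    fix x assume "x \<in> space M" "\<forall>g\<in>K. tuple_mult I g x \<notin> U"
    then show False using K(3)[of x] unfolding space_M by blast
  qed
  then show False by simp
qed

lemma zero_set_open: "entry_poly I F \<Longrightarrow> openin (SO_power_top I) {x \<in> SO_tuples I. F x \<noteq> 0}"
  using openin_continuous_map_preimage[OF entry_poly_continuous, of I F "- {0}"]
  by (simp add: open_Compl)

lemma zero_set_measurable [measurable]:
  assumes "entry_poly I F" shows "{x \<in> SO_tuples I. F x = 0} \<in> sets M"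
proof -
  have "{x \<in> SO_tuples I. F x = 0} = space M - {x \<in> SO_tuples I. F x \<noteq> 0}"
    by (auto simp: space_M)
  then show ?thesis using openin_measurable[OF zero_set_open[OF assms]] by simp
qed

abbreviation single :: "nat \<Rightarrow> real ^ 'd ^ 'd \<Rightarrow> nat \<Rightarrow> real ^ 'd ^ 'd" where
  "single i A \<equiv> (\<lambda>j\<in>I. if j = i then A else mat 1)"

lemma single_in_SO_tuples: "A \<in> SO \<Longrightarrow> single i A \<in> SO_tuples I"
  by (auto simp: SO_tuples_def SO_one)

lemma tuple_mult_single:
  "x \<in> SO_tuples I \<Longrightarrow> i \<in> I \<Longrightarrow> tuple_mult I (single i A) x = x(i := A ** x i)"
  by (auto simp: fun_eq_iff SO_tuples_def PiE_def extensional_def)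

text \<open>
  The reverse Fatou lemma for sets.
\<close>

lemma measure_limsup_ge:
  fixes A :: "nat \<Rightarrow> (nat \<Rightarrow> real ^ 'd ^ 'd) set"
  assumes A: "\<And>n. A n \<in> sets M" and c: "\<And>n. c \<le> prob (A n)"
  shows "c \<le> prob (\<Inter>n. \<Union>k\<in>{n..}. A k)"
proof -
  let ?B = "\<lambda>n. \<Union>k\<in>{n..}. A k"
  have B: "?B n \<in> sets M" for n using A by (intro sets.countable_UN'') auto
  have "decseq ?B" unfolding decseq_def by (intro allI impI UN_mono) auto
  then have lim: "(\<lambda>n. prob (?B n)) \<longlonglongrightarrow> prob (\<Inter>n. ?B n)"
    using B by (intro finite_Lim_measure_decseq) blast
  have "c \<le> prob (?B n)" for n
    by (rule order_trans[OF c finite_measure_mono[OF _ B]]) auto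
  then have "\<exists>m. \<forall>n\<ge>m. c \<le> prob (?B n)" by blast
  with lim show ?thesis by (rule LIMSEQ_le_const)
qed

text \<open>
  The curve \<open>c\<close> runs from the identity to the product of the two reflections.  For \<open>t = 1, 1/2, 1/3, \<dots>\<close>
  the sets of those \<open>x\<close> whose translate by \<open>c t\<close> is a zero of \<open>F\<close> all have the measure of the zero set \<open>Z\<close>,
  hence so many \<open>x\<close> belong to infinitely many of them.  For such \<open>x\<close> the rational function
  \<open>t \<mapsto> F(c(t) x)\<close> has infinitely many zeros and vanishes identically; the values \<open>t = 0\<close> and \<open>t = 1\<close> show
  that \<open>x\<close> and its translate are in \<open>Z\<close>.
\<close>

lemma zero_set_invariant_step:
  assumes F: "entry_poly I F" and i: "i \<in> I" and u: "u \<noteq> 0" and v: "v \<noteq> 0"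
  shows "AE x in M. F x = 0 \<longrightarrow> F (tuple_mult I (single i (householder v ** householder u)) x) = 0"
proof (cases "\<exists>t. segment_point u v t = 0")
  case True
  then have "householder u = householder v" using householder_segment_degenerate u v by blast
  then have "householder v ** householder u = mat 1" using householder_involution[OF u] by simp
  then show ?thesis
    by (auto intro!: AE_I2 simp: tuple_mult_single[OF _ i] space_M simp del: restrict_apply)
next
  case False
  then have nz: "segment_point u v t \<noteq> 0" for t by blast
  define c where "c t = householder (segment_point u v t) ** householder u" for t
  define Z where "Z = {x \<in> SO_tuples I. F x = 0}"
  define A where "A n = tuple_mult I (single i (c (1 / real (Suc n)))) -` Z \<inter> space M" for n
  define W where "W = (\<Inter>n. \<Union>k\<in>{n..}. A k)"
  have Z[measurable]: "Z \<in> sets M" unfolding Z_def by (rule zero_set_measurable[OF F])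
  have cSO: "c t \<in> SO" for t
    using nz u by (simp add: c_def SO_iff orthogonal_matrix_mul orthogonal_householder det_mul det_householder)
  have A: "A n \<in> sets M" for n
    unfolding A_def by (intro measurable_sets[OF measurable_tuple_mult Z] single_in_SO_tuples cSO)
  have "prob (A n) = prob Z" for n
    unfolding A_def
    by (subst (2) invariant[OF single_in_SO_tuples[OF cSO], of i "1 / real (Suc n)", symmetric])
       (rule measure_distr[symmetric, OF measurable_tuple_mult[OF single_in_SO_tuples[OF cSO]] Z])
  then have ge: "prob Z \<le> prob W" unfolding W_def by (intro measure_limsup_ge A) simp
  have W: "F (tuple_mult I (single i (c t)) x) = 0" "x \<in> SO_tuples I" if x: "x \<in> W" for x t
  proof -
    obtain k where "x \<in> A k" using x by (auto simp: W_def)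
    then show xS: "x \<in> SO_tuples I" by (simp add: A_def space_M)
    obtain p n where p: "\<And>t. F (x(i := householder (segment_point u v t) ** (householder u ** x i))) *
      (segment_point u v t \<bullet> segment_point u v t) ^ n = poly p t"
      using entry_poly_along_segment[OF F, of u v x i "householder u ** x i"] nz by blast
    have iff: "poly p t = 0 \<longleftrightarrow> F (tuple_mult I (single i (c t)) x) = 0" for t
      using nz[of t] by (simp add: p[symmetric] tuple_mult_single[OF xS i] c_def matrix_mul_assoc del: restrict_apply)
    have "\<exists>k\<ge>n. poly p (1 / real (Suc k)) = 0" for n
      using x unfolding iff by (auto simp: W_def A_def Z_def)
    then have "infinite {k. poly p (1 / real (Suc k)) = 0}"
      by (auto simp: infinite_nat_iff_unbounded_le)
    then have "infinite ((\<lambda>k. 1 / real (Suc k)) ` {k. poly p (1 / real (Suc k)) = 0})"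
      by (subst finite_image_iff) (auto simp: inj_on_def)
    then have "infinite {t. poly p t = 0}"
      by (rule contrapos_nn) (auto elim: finite_subset[rotated])
    then have "p = 0" using poly_roots_finite by blast
    then show "F (tuple_mult I (single i (c t)) x) = 0" using iff by simp
  qed
  have c0: "c 0 = mat 1" and c1: "c 1 = householder v ** householder u"
    by (simp_all add: c_def segment_point_def householder_involution[OF u])
  have "W \<subseteq> Z"
  proof
    fix x assume "x \<in> W"
    then have "F (tuple_mult I (single i (c 0)) x) = 0" "x \<in> SO_tuples I" using W by auto
    then show "x \<in> Z" by (simp add: Z_def tuple_mult_single[OF _ i] c0 del: restrict_apply)
  qed
  have Wm: "W \<in> sets M" unfolding W_def using A by auto
  have "prob (Z - W) = 0"
    using finite_measure_Diff[OF Z Wm \<open>W \<subseteq> Z\<close>] ge measure_nonneg[of M "Z - W"] by linarith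
  then have "Z - W \<in> null_sets M"
    using Z Wm by (auto simp: null_sets_def emeasure_eq_measure)
  then have "AE x in M. x \<notin> Z - W" by (rule AE_not_in)
  then show ?thesis
  proof (rule AE_mp, intro AE_I2 impI)
    fix x assume "x \<in> space M" "x \<notin> Z - W" "F x = 0"
    then have "x \<in> W" by (auto simp: Z_def space_M)
    from W(1)[OF this, of 1] show "F (tuple_mult I (single i (householder v ** householder u)) x) = 0"
      by (simp only: c1)
  qed
qed

lemma zero_set_invariant_mult:
  assumes h: "h \<in> SO_tuples I"
    and "AE x in M. F x = 0 \<longrightarrow> F (tuple_mult I g x) = 0" "AE x in M. F x = 0 \<longrightarrow> F (tuple_mult I h x) = 0"
  shows "AE x in M. F x = 0 \<longrightarrow> F (tuple_mult I (tuple_mult I g h) x) = 0"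
  using AE_tuple_mult[OF h assms(2)] assms(3)
  unfolding tuple_mult_assoc by eventually_elim simp

text \<open>
  Almost invariance passes to products, hence from pairs of reflections in one coordinate to all
  rotations in one coordinate, and then to all tuples, one coordinate at a time.
\<close>

lemma zero_set_invariant:
  assumes F: "entry_poly I F" and g: "g \<in> SO_tuples I"
  shows "AE x in M. F x = 0 \<longrightarrow> F (tuple_mult I g x) = 0"
proof -
  have id: "AE x in M. F x = 0 \<longrightarrow> F (tuple_mult I (\<lambda>j\<in>I. mat 1) x) = 0"
  proof (intro AE_I2 impI)
    fix x assume "x \<in> space M" "F x = 0"
    moreover from this have "tuple_mult I (\<lambda>j\<in>I. mat 1) x = x"
      by (auto simp: fun_eq_iff space_M SO_tuples_def PiE_def extensional_def)
    ultimately show "F (tuple_mult I (\<lambda>j\<in>I. mat 1) x) = 0" by (simp only:)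
  qed
  have single: "AE x in M. F x = 0 \<longrightarrow> F (tuple_mult I (single i Q) x) = 0" if Q: "Q \<in> SO" and i: "i \<in> I" for Q i
    using Q
  proof (induction rule: SO_induct)
    case one
    show ?case using id by (simp only: if_cancel)
  next
    case (step u v Q)
    have "tuple_mult I (single i (householder v ** householder u)) (single i Q)
        = single i (householder v ** householder u ** Q)"
      by auto
    then show ?case
      using zero_set_invariant_mult[OF single_in_SO_tuples[OF step(3)] zero_set_invariant_step[OF F i step(1,2)] step(4)]
      by (simp only:)
  qed
  have "AE x in M. F x = 0 \<longrightarrow> F (tuple_mult I (\<lambda>j\<in>I. if j \<in> J then g j else mat 1) x) = 0" if "J \<subseteq> I" for J
    using finite_subset[OF that finI] that
  proof (induction J rule: finite_induct)
    case empty show ?case using id by (simp only: empty_iff if_False)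
  next
    case (insert i J)
    have i: "i \<in> I" "g i \<in> SO" using insert.prems SO_tuplesD[OF g] by auto
    have m: "(\<lambda>j\<in>I. if j \<in> J then g j else mat 1) \<in> SO_tuples I"
      using g by (auto simp: SO_tuples_def SO_one)
    have "tuple_mult I (single i (g i)) (\<lambda>j\<in>I. if j \<in> J then g j else mat 1)
        = (\<lambda>j\<in>I. if j \<in> insert i J then g j else mat 1)"
      using insert.hyps by auto
    then show ?case
      using zero_set_invariant_mult[OF m single[OF i(2,1)] insert.IH] insert.prems by simp
  qed
  from this[OF subset_refl] show ?thesis
    using g by (simp add: SO_tuples_def PiE_def extensional_restrict cong: restrict_cong)
qed

text \<open>
  Each point is moved off the zero set by one of finitely many translations, but each of these
  moves almost no point of the zero set off it.
\<close>

theorem zero_set_null: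
  assumes F: "entry_poly I F" and y: "y \<in> SO_tuples I" "F y \<noteq> 0"
  shows "AE x in M. F x \<noteq> 0"
proof -
  have "{x \<in> SO_tuples I. F x \<noteq> 0} \<noteq> {}" using y by blast
  from finite_translates_cover[OF zero_set_open[OF F] this]
  obtain K where K: "finite K" "K \<subseteq> SO_tuples I"
    "\<And>x. x \<in> SO_tuples I \<Longrightarrow> \<exists>g\<in>K. tuple_mult I g x \<in> {x \<in> SO_tuples I. F x \<noteq> 0}"
    by blast
  have "AE x in M. \<forall>g\<in>K. F x = 0 \<longrightarrow> F (tuple_mult I g x) = 0"
    by (intro AE_finite_allI K(1) zero_set_invariant[OF F]) (use K(2) in auto)
  then show ?thesis
  proof (rule AE_mp, intro AE_I2 impI)
    fix x assume "x \<in> space M" "\<forall>g\<in>K. F x = 0 \<longrightarrow> F (tuple_mult I g x) = 0"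
    then show "F x \<noteq> 0" using K(3)[of x] unfolding space_M by blast
  qed
qed

lemma zero_set_nowhere_dense:
  fixes F :: "(nat \<Rightarrow> real ^ 'd ^ 'd) \<Rightarrow> real"
  assumes F: "entry_poly I F" and y: "y \<in> SO_tuples I" "F y \<noteq> 0"
  shows "nowhere_dense_in (SO_power_top I) {x \<in> SO_tuples I. F x = 0}"
proof -
  let ?Z = "{x \<in> SO_tuples I. F x = 0}"
  have "?Z = topspace (SO_power_top I) - {x \<in> SO_tuples I. F x \<noteq> 0}" by auto
  then have cl: "closedin (SO_power_top I) ?Z"
    using zero_set_open[OF F] by (metis (no_types, lifting) closedin_diff closedin_topspace)
  have "(SO_power_top I) interior_of ?Z = {}"
  proof (rule ccontr)
    let ?U = "(SO_power_top I) interior_of ?Z"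
    assume "?U \<noteq> {}"
    then have "\<not> (AE x in M. x \<notin> ?U)" by (intro open_not_null openin_interior_of)
    moreover have "AE x in M. x \<notin> ?U"
      using zero_set_null[OF assms]
    proof (rule AE_mp, intro AE_I2 impI)
      fix x assume "F x \<noteq> 0"
      then show "x \<notin> ?U" using interior_of_subset[of "SO_power_top I" ?Z] by blast
    qed
    ultimately show False by blast
  qed
  with cl show ?thesis
    by (auto simp: nowhere_dense_in_def closure_of_eq[THEN iffD2])
qed

end

text \<open>
  Being a subset of a countable union of such zero sets suffices for both notions of smallness: nowhere
  dense sets may be shrunk, and Haar-null sets refer to the completed measure.
\<close>

theorem meager_and_haar_null_if_covered_by_zero_sets:
  fixes F :: "'n::countable \<Rightarrow> (nat \<Rightarrow> real ^ 'd ^ 'd) \<Rightarrow> real"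
  assumes I: "finite I" and F: "\<And>n. entry_poly I (F n)" "\<And>n. \<exists>y\<in>SO_tuples I. F n y \<noteq> 0"
    and D: "D \<subseteq> SO_tuples I" "\<And>x. x \<in> D \<Longrightarrow> \<exists>n. F n x = 0"
  shows "meager_in (SO_power_top I) D \<and> haar_null (SO_power I) (SO_power_top I) D"
proof -
  obtain M :: "(nat \<Rightarrow> real ^ 'd ^ 'd) measure"
    where M: "haar_probability (SO_power I) (SO_power_top I) M"
      "sets M = sets (open_algebra (SO_power_top I))"
      "\<And>g. g \<in> SO_tuples I \<Longrightarrow> distr M M (tuple_mult I g) = M"
    using ex_haar_SO_power[OF I] by blast
  have "prob_space M" using M(1) unfolding haar_probability_def by (elim conjE)
  then interpret haar_power M I
    by (intro haar_power.intro haar_power_axioms.intro) (use I M in auto)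
  let ?Z = "\<lambda>n. {x \<in> SO_tuples I. F n x = 0}"
  have nd: "nowhere_dense_in (SO_power_top I) (?Z n)" for n
    using F by (auto intro: zero_set_nowhere_dense)
  have D_sub: "D \<subseteq> (\<Union>n. ?Z n)" using D by blast
  have "meager_in (SO_power_top I) D"
    unfolding meager_in_def
  proof (intro exI[of _ "\<lambda>k. D \<inter> ?Z (from_nat k)"] conjI allI)
    fix k
    have "SO_power_top I interior_of (SO_power_top I closure_of (D \<inter> ?Z (from_nat k)))
        \<subseteq> SO_power_top I interior_of (SO_power_top I closure_of ?Z (from_nat k))"
      by (intro interior_of_mono closure_of_mono) auto
    then show "nowhere_dense_in (SO_power_top I) (D \<inter> ?Z (from_nat k))"
      using nd[of "from_nat k"] D(1) by (auto simp: nowhere_dense_in_def)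
    show "D = (\<Union>k. D \<inter> ?Z (from_nat k))"
    proof (intro equalityI subsetI)
      fix x assume "x \<in> D"
      then obtain n where "x \<in> ?Z n" using D_sub by blast
      then have "x \<in> D \<inter> ?Z (from_nat (to_nat n))" using \<open>x \<in> D\<close> by simp
      then show "x \<in> (\<Union>k. D \<inter> ?Z (from_nat k))" by blast
    qed blast
  qed
  moreover have "D \<in> null_sets (completion M)"
  proof (rule null_sets_completion_subset[OF D_sub])
    have "?Z n \<in> null_sets M" for n
    proof -
      obtain y where "y \<in> SO_tuples I" "F n y \<noteq> 0" using F(2) by blast
      from zero_set_null[OF F(1) this] have "AE x in M. x \<notin> ?Z n" by auto
      then show ?thesis using zero_set_measurable[OF F(1)] by (simp add: AE_iff_null_sets)
    qed
    then show "(\<Union>n. ?Z n) \<in> null_sets (completion M)"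
      by (intro null_sets_completionI null_sets_UN' countableI_type)
  qed
  ultimately show ?thesis using haar by (auto simp: haar_null_def)
qed

section \<open>Rotations and the spherical measure\<close>

lemma space_spherical_measure [simp]: "space spherical_measure = sphere 0 1"
  by (simp add: spherical_measure_def space_measure_of_conv)

lemma restrict_sphere_sigma:
  "sigma_sets (sphere 0 1) (sets (restrict_space borel (sphere 0 1 :: (real ^ 'd) set)))
    = sets (restrict_space borel (sphere 0 1))"
  using sets.sigma_sets_eq[of "restrict_space borel (sphere 0 1 :: (real ^ 'd) set)"]
  by (simp add: space_restrict_space)

lemma sets_spherical_measure [measurable_cong]:
  "sets (spherical_measure :: (real ^ 'd) measure) = sets (restrict_space borel (sphere 0 1))"
proof -
  have "sets (restrict_space borel (sphere 0 1)) \<subseteq> Pow (sphere (0 :: real ^ 'd) 1)"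
    using sets.space_closed[of "restrict_space borel (sphere (0 :: real ^ 'd) 1)"]
    by (simp add: space_restrict_space)
  then show ?thesis
    unfolding spherical_measure_def by (simp add: sets_measure_of restrict_sphere_sigma)
qed

lemma ediam_image:
  assumes "U \<subseteq> X" "\<And>x y. x \<in> X \<Longrightarrow> y \<in> X \<Longrightarrow> \<rho> (f x) (f y) = \<rho> x y"
  shows "ediam \<rho> (f ` U) = ediam \<rho> U"
  unfolding ediam_def image_image using assms by (intro SUP_cong refl) (simp add: subset_iff)

text \<open>
  An isometry carries covers of \<open>A\<close> to covers of its image with the same diameters.
\<close>

lemma hausdorff_outer_image_le:
  assumes f: "f ` X \<subseteq> X" and iso: "\<And>x y. x \<in> X \<Longrightarrow> y \<in> X \<Longrightarrow> \<rho> (f x) (f y) = \<rho> x y"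
  shows "hausdorff_outer X \<rho> s (f ` A) \<le> hausdorff_outer X \<rho> s A"
  unfolding hausdorff_outer_def
proof (intro SUP_mono bexI INF_greatest)
  fix \<delta> :: real and U :: "nat \<Rightarrow> 'a set"
  assume U: "U \<in> {U. (\<forall>i. U i \<subseteq> X \<and> ediam \<rho> (U i) \<le> ennreal \<delta>) \<and> A \<subseteq> (\<Union>i. U i)}"
  have ed: "ediam \<rho> (f ` U i) = ediam \<rho> (U i)" for i
    using U iso by (intro ediam_image[where X = X]) auto
  show "(INF U\<in>{U. (\<forall>i. U i \<subseteq> X \<and> ediam \<rho> (U i) \<le> ennreal \<delta>) \<and> f ` A \<subseteq> (\<Union>i. U i)}.
      (\<Sum>i. ediam \<rho> (U i) ^ s)) \<le> (\<Sum>i. ediam \<rho> (U i) ^ s)"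
  proof (rule INF_lower2[of "\<lambda>i. f ` U i"])
    have "f ` U i \<subseteq> X" for i using U f by blast
    moreover have "f ` A \<subseteq> (\<Union>i. f ` U i)" using U by blast
    ultimately show "(\<lambda>i. f ` U i) \<in> {U. (\<forall>i. U i \<subseteq> X \<and> ediam \<rho> (U i) \<le> ennreal \<delta>) \<and> f ` A \<subseteq> (\<Union>i. U i)}"
      using U ed by simp
  qed (simp add: ed)
qed auto

lemma SO_inner: "g \<in> SO \<Longrightarrow> (g *v x) \<bullet> (g *v y) = x \<bullet> y"
  by (simp add: SO_iff orthogonal_matrix_mult_vec_inner)

lemma SO_norm: "g \<in> SO \<Longrightarrow> norm (g *v x) = norm x"
  by (simp add: SO_iff orthogonal_matrix_mult_vec_norm)

lemma SO_transpose_mult_vec: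
  assumes "g \<in> SO" shows "transpose g *v (g *v x) = x" "g *v (transpose g *v x) = x"
  using assms by (simp_all add: matrix_vector_mul_assoc SO_transpose_mult del: transpose_matrix_vector)

lemma hausdorff_outer_rotation:
  assumes g: "g \<in> SO"
  shows "hausdorff_outer (sphere 0 1) geodesic_dist s ((*v) g ` A) = hausdorff_outer (sphere 0 1) geodesic_dist s A"
proof (rule antisym)
  have *: "hausdorff_outer (sphere 0 1) geodesic_dist s ((*v) h ` B) \<le> hausdorff_outer (sphere 0 1) geodesic_dist s B"
    if "h \<in> SO" for h :: "real ^ 'a ^ 'a" and B
    by (rule hausdorff_outer_image_le) (auto simp: SO_norm SO_inner that geodesic_dist_def)
  show "hausdorff_outer (sphere 0 1) geodesic_dist s ((*v) g ` A) \<le> hausdorff_outer (sphere 0 1) geodesic_dist s A"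
    by (rule *[OF g])
  have "(*v) (transpose g) ` (*v) g ` A = A"
    by (simp add: image_image SO_transpose_mult_vec[OF g] del: transpose_matrix_vector)
  with *[OF SO_transpose[OF g], of "(*v) g ` A"]
  show "hausdorff_outer (sphere 0 1) geodesic_dist s A \<le> hausdorff_outer (sphere 0 1) geodesic_dist s ((*v) g ` A)"
    by simp
qed

lemma measurable_rotation [measurable]:
  fixes g :: "real ^ 'd ^ 'd"
  assumes g: "g \<in> SO" shows "(*v) g \<in> measurable spherical_measure spherical_measure"
proof -
  have "(*v) g \<in> borel_measurable borel"
    by (intro borel_measurable_continuous_onI linear_continuous_on) (simp add: matrix_vector_mul_bounded_linear)
  then have "(*v) g \<in> measurable (restrict_space borel (sphere 0 1)) (restrict_space borel (sphere 0 1))"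
    by (intro measurable_restrict_space2 measurable_restrict_space1) (auto simp: space_restrict_space SO_norm[OF g])
  then show ?thesis
    using measurable_cong_sets[OF sets_spherical_measure sets_spherical_measure] by blast
qed

text \<open>
  The value of \<^const>\<open>measure_of\<close> on a measurable set is that of the outer measure, under a condition
  in which the set does not occur, and zero otherwise; in both cases it inherits the invariance of
  the outer measure under isometries.
\<close>

lemma spherical_measure_rotation:
  fixes g :: "real ^ 'd ^ 'd"
  assumes g: "g \<in> SO" shows "distr spherical_measure spherical_measure ((*v) g) = spherical_measure"
proof (rule measure_eqI)
  fix A assume "A \<in> sets (distr spherical_measure spherical_measure ((*v) g))"
  then have A: "A \<in> sets (spherical_measure :: (real ^ 'd) measure)" by simp
  let ?B = "(*v) g -` A \<inter> space spherical_measure"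
  have B: "?B \<in> sets (spherical_measure :: (real ^ 'd) measure)"
    by (rule measurable_sets[OF measurable_rotation[OF g] A])
  have "A \<subseteq> sphere 0 1" using sets.sets_into_space[OF A] by simp
  have "?B = (*v) (transpose g) ` A"
  proof (intro equalityI subsetI)
    fix v assume "v \<in> ?B"
    then show "v \<in> (*v) (transpose g) ` A"
      by (intro image_eqI[of _ _ "g *v v"]) (simp_all add: SO_transpose_mult_vec[OF g] del: transpose_matrix_vector)
  next
    fix v assume "v \<in> (*v) (transpose g) ` A"
    then obtain w where "w \<in> A" "v = transpose g *v w" by blast
    then show "v \<in> ?B"
      using \<open>A \<subseteq> sphere 0 1\<close>
      by (auto simp: SO_transpose_mult_vec[OF g] SO_norm[OF SO_transpose[OF g]] simp del: transpose_matrix_vector)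
  qed
  then have "hausdorff_outer (sphere 0 1) geodesic_dist (CARD('d) - 1) ?B
      = hausdorff_outer (sphere 0 1) geodesic_dist (CARD('d) - 1) A"
    by (simp only: hausdorff_outer_rotation[OF SO_transpose[OF g]])
  then have "emeasure spherical_measure ?B = emeasure spherical_measure A"
    using A B by (simp only: sets_spherical_measure)
      (simp only: spherical_measure_def emeasure_measure_of_conv restrict_sphere_sigma if_True simp_thms)
  then show "emeasure (distr spherical_measure spherical_measure ((*v) g)) A = emeasure spherical_measure A"
    by (simp only: emeasure_distr[OF measurable_rotation[OF g] A])
qed simp

lemma matrix_inv_SO:
  fixes g :: "real ^ 'd ^ 'd"
  assumes "g \<in> SO" shows "matrix_inv g = transpose g"
proof -
  have "g ** matrix_inv g = mat 1 \<and> matrix_inv g ** g = mat 1"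
    unfolding matrix_inv_def by (rule someI[of _ "transpose g"]) (simp add: SO_transpose_mult[OF assms])
  then have "transpose g ** (g ** matrix_inv g) = transpose g" by simp
  then show ?thesis by (simp add: matrix_mul_assoc SO_transpose_mult[OF assms])
qed

lemma integral_rotation:
  fixes f :: "real ^ 'd \<Rightarrow> 'b::{banach, second_countable_topology}"
  assumes "g \<in> SO" "f \<in> borel_measurable spherical_measure"
  shows "(\<integral>v. f (g *v v) \<partial>spherical_measure) = (\<integral>v. f v \<partial>spherical_measure)"
    and "integrable spherical_measure (\<lambda>v. f (g *v v)) \<longleftrightarrow> integrable spherical_measure f"
  using integral_distr[OF measurable_rotation[OF assms(1)] assms(2)]
    integrable_distr_eq[OF measurable_rotation[OF assms(1)] assms(2)] spherical_measure_rotation[OF assms(1)]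
  by simp_all

text \<open>
  The constant \<open>1\<close> is almost everywhere a sum of rotated copies of a square integrable function, so it
  is square integrable itself.
\<close>

lemma finite_spherical_measure:
  fixes \<gamma> :: "nat \<Rightarrow> real ^ 'd ^ 'd"
  assumes \<gamma>: "\<And>i. i \<in> {1..r} \<Longrightarrow> \<gamma> i \<in> SO" and f: "f \<in> L2 spherical_measure"
    and sum: "AE v in spherical_measure. (\<Sum>i=1..r. act (\<gamma> i) f v) = 1"
  shows "finite_measure (spherical_measure :: (real ^ 'd) measure)"
proof -
  let ?M = "spherical_measure :: (real ^ 'd) measure"
  have fm: "f \<in> borel_measurable ?M" and f2: "integrable ?M (\<lambda>v. (f v)\<^sup>2)" using f by (auto simp: L2_def)
  have "integrable ?M (\<lambda>v. (act (\<gamma> i) f v)\<^sup>2)" if "i \<in> {1..r}" for i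
    unfolding act_def matrix_inv_SO[OF \<gamma>[OF that]]
    using f2 by (subst integral_rotation(2)[OF SO_transpose[OF \<gamma>[OF that]]]) (use fm in measurable)
  then have int: "integrable ?M (\<lambda>v. (\<Sum>i=1..r. (act (\<gamma> i) f v)\<^sup>2) * real (card {1..r}))"
    by (intro integrable_mult_left integrable_sum) auto
  have "integrable ?M (\<lambda>v. 1 :: real)"
  proof (rule Bochner_Integration.integrable_bound[OF int])
    show "AE v in ?M. norm (1 :: real) \<le> norm ((\<Sum>i=1..r. (act (\<gamma> i) f v)\<^sup>2) * real (card {1..r}))"
      using sum
    proof eventually_elim
      fix v assume "(\<Sum>i=1..r. act (\<gamma> i) f v) = 1"
      then have "1 \<le> (\<Sum>i=1..r. (act (\<gamma> i) f v)\<^sup>2) * real (card {1..r})"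
        using sum_squared_le_sum_of_squares[of "\<lambda>i. act (\<gamma> i) f v" "{1..r}"] by simp
      then show "norm (1 :: real) \<le> norm ((\<Sum>i=1..r. (act (\<gamma> i) f v)\<^sup>2) * real (card {1..r}))" by simp
    qed
  qed simp
  then have "emeasure ?M (space ?M) < \<infinity>" by (simp add: integrable_iff_bounded)
  then show ?thesis by (intro finite_measureI) auto
qed

lemma borel_measurable_spherical:
  "\<phi> \<in> borel_measurable borel \<Longrightarrow> \<phi> \<in> borel_measurable (spherical_measure :: (real ^ 'd) measure)"
  using measurable_cong_sets[OF sets_spherical_measure refl] measurable_restrict_space1 by blast

lemma integrable_scaleR_continuous:
  fixes \<phi> :: "real ^ 'd \<Rightarrow> 'b::{banach, second_countable_topology}"
  assumes h: "integrable spherical_measure h" and \<phi>: "continuous_on UNIV \<phi>"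
  shows "integrable spherical_measure (\<lambda>v. h v *\<^sub>R \<phi> v)"
proof -
  have "compact (\<phi> ` sphere 0 1)"
    by (intro compact_continuous_image continuous_on_subset[OF \<phi>]) auto
  then obtain B where B: "\<And>v. v \<in> sphere 0 1 \<Longrightarrow> norm (\<phi> v) \<le> B"
    by (metis bounded_iff compact_imp_bounded imageI)
  have m: "\<phi> \<in> borel_measurable spherical_measure"
    by (intro borel_measurable_spherical borel_measurable_continuous_onI \<phi>)
  show ?thesis
  proof (rule Bochner_Integration.integrable_bound)
    show "integrable spherical_measure (\<lambda>v. h v * B)" using h by simp
    show "(\<lambda>v. h v *\<^sub>R \<phi> v) \<in> borel_measurable spherical_measure"
      using borel_measurable_integrable[OF h] m by measurable
    show "AE v in spherical_measure. norm (h v *\<^sub>R \<phi> v) \<le> norm (h v * B)"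
    proof (intro AE_I2)
      fix v :: "real ^ 'd" assume "v \<in> space spherical_measure"
      then have "norm (\<phi> v) \<le> \<bar>B\<bar>" using B[of v] by simp
      then show "norm (h v *\<^sub>R \<phi> v) \<le> norm (h v * B)" by (simp add: abs_mult mult_left_mono)
    qed
  qed
qed

text \<open>
  Integrate the relation between the rotated copies of \<open>h\<close> against \<open>\<phi>\<close>, and move the rotations from
  \<open>h\<close> to \<open>\<phi>\<close> by invariance of the measure.
\<close>

lemma moment_relation:
  fixes \<phi> :: "real ^ 'd \<Rightarrow> 'b::{banach, second_countable_topology}"
  assumes \<gamma>: "\<And>i. i \<in> J \<Longrightarrow> \<gamma> i \<in> SO" and h: "integrable spherical_measure h"
    and sum: "AE v in spherical_measure. (\<Sum>i\<in>J. act (\<gamma> i) h v) = 0" and \<phi>: "continuous_on UNIV \<phi>"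
  shows "(\<Sum>i\<in>J. \<integral>v. h v *\<^sub>R \<phi> (\<gamma> i *v v) \<partial>spherical_measure) = 0"
proof -
  let ?M = "spherical_measure :: (real ^ 'd) measure"
  have \<phi>g: "continuous_on UNIV (\<lambda>v. \<phi> (g *v v))" for g :: "real ^ 'd ^ 'd"
    by (intro continuous_on_compose2[OF \<phi>] linear_continuous_on) (auto simp: matrix_vector_mul_bounded_linear)
  have eq: "(\<integral>v. h v *\<^sub>R \<phi> (\<gamma> i *v v) \<partial>?M) = (\<integral>v. act (\<gamma> i) h v *\<^sub>R \<phi> v \<partial>?M)"
    and int: "integrable ?M (\<lambda>v. act (\<gamma> i) h v *\<^sub>R \<phi> v)" if "i \<in> J" for i
  proof -
    note g = \<gamma>[OF that]
    have i: "integrable ?M (\<lambda>v. h v *\<^sub>R \<phi> (\<gamma> i *v v))" by (rule integrable_scaleR_continuous[OF h \<phi>g])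
    show "(\<integral>v. h v *\<^sub>R \<phi> (\<gamma> i *v v) \<partial>?M) = (\<integral>v. act (\<gamma> i) h v *\<^sub>R \<phi> v \<partial>?M)"
      using integral_rotation(1)[OF SO_transpose[OF g] borel_measurable_integrable[OF i]]
      by (simp add: act_def matrix_inv_SO[OF g] SO_transpose_mult_vec[OF g] del: transpose_matrix_vector)
    show "integrable ?M (\<lambda>v. act (\<gamma> i) h v *\<^sub>R \<phi> v)"
      using integral_rotation(2)[OF SO_transpose[OF g] borel_measurable_integrable[OF i]] i
      by (simp add: act_def matrix_inv_SO[OF g] SO_transpose_mult_vec[OF g] del: transpose_matrix_vector)
  qed
  have "(\<Sum>i\<in>J. \<integral>v. h v *\<^sub>R \<phi> (\<gamma> i *v v) \<partial>?M) = (\<integral>v. (\<Sum>i\<in>J. act (\<gamma> i) h v *\<^sub>R \<phi> v) \<partial>?M)"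
    by (simp add: eq int)
  also have "\<dots> = (\<integral>v. 0 \<partial>?M)"
  proof (rule integral_cong_AE)
    show "(\<lambda>v. \<Sum>i\<in>J. act (\<gamma> i) h v *\<^sub>R \<phi> v) \<in> borel_measurable ?M"
      using int by (intro borel_measurable_sum) auto
    show "AE v in ?M. (\<Sum>i\<in>J. act (\<gamma> i) h v *\<^sub>R \<phi> v) = 0"
      using sum by eventually_elim (simp flip: scaleR_sum_left)
  qed simp
  finally show ?thesis by simp
qed

section \<open>Integrable functions on the sphere are determined by their moments\<close>

text \<open>
  Words over the index type name the monomials, with repetitions from reordering the letters; so the
  words of length \<open>n\<close> also index the entries of a tensor of order \<open>n\<close>.
\<close>

definition monomial :: "'d list \<Rightarrow> real ^ 'd \<Rightarrow> real" where
  "monomial w v = prod_list (map (\<lambda>k. v $ k) w)"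

lemma monomial_simps [simp]: "monomial [] v = 1" "monomial (k # w) v = v $ k * monomial w v"
  by (simp_all add: monomial_def)

lemma continuous_on_monomial: "continuous_on S (monomial w)"
proof (induction w)
  case (Cons k w)
  then show ?case unfolding monomial_simps by (intro continuous_intros)
qed simp

lemma polynomial_moment_zero:
  fixes h :: "real ^ 'd \<Rightarrow> real"
  assumes h: "integrable spherical_measure h"
    and zero: "\<And>w. (\<integral>v. h v * monomial w v \<partial>spherical_measure) = 0"
    and p: "real_polynomial_function p"
  shows "(\<integral>v. h v * p v \<partial>spherical_measure) = 0"
proof -
  \<comment> \<open>Multiplication by \<open>p\<close> preserves the functions whose moments against \<open>h\<close> all vanish; this stronger claim survives products.\<close>
  define good where "good q \<longleftrightarrow> continuous_on UNIV q \<and>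
    (\<forall>w. (\<integral>v. h v * (q v * monomial w v) \<partial>spherical_measure) = 0)" for q :: "real ^ 'd \<Rightarrow> real"
  have int: "integrable spherical_measure (\<lambda>v. h v * q v)" if "continuous_on UNIV q" for q :: "real ^ 'd \<Rightarrow> real"
    using integrable_scaleR_continuous[OF h that] by simp
  have "good (\<lambda>v. p v * q v)" if "good q" for q
    using p that
  proof (induction arbitrary: q)
    case (linear f)
    then have q: "continuous_on UNIV q" "\<And>w. (\<integral>v. h v * (q v * monomial w v) \<partial>spherical_measure) = 0"
      by (auto simp: good_def)
    have f: "f v = (\<Sum>k\<in>UNIV. f (axis k 1) * v $ k)" for v
    proof -
      have "f v = f (\<Sum>k\<in>UNIV. v $ k *\<^sub>R axis k 1)"
        by (simp add: basis_expansion scalar_mult_eq_scaleR[symmetric])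
      also have "\<dots> = (\<Sum>k\<in>UNIV. f (axis k 1) * v $ k)"
        using linear.hyps by (simp add: linear_sum linear_cmul bounded_linear.linear mult.commute)
      finally show ?thesis .
    qed
    have "(\<integral>v. h v * (f v * q v * monomial w v) \<partial>spherical_measure)
        = (\<Sum>k\<in>UNIV. f (axis k 1) * (\<integral>v. h v * (q v * monomial (k # w) v) \<partial>spherical_measure))" for w
    proof -
      have "(\<integral>v. h v * (f v * q v * monomial w v) \<partial>spherical_measure)
          = (\<integral>v. (\<Sum>k\<in>UNIV. f (axis k 1) * (h v * (q v * monomial (k # w) v))) \<partial>spherical_measure)"
        by (subst f) (simp add: sum_distrib_left sum_distrib_right mult_ac)
      also have "\<dots> = (\<Sum>k\<in>UNIV. f (axis k 1) * (\<integral>v. h v * (q v * monomial (k # w) v) \<partial>spherical_measure))"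
        using int[of "\<lambda>v. q v * monomial (_ # w) v"] q(1)
        by (subst Bochner_Integration.integral_sum) 
           (auto intro!: integrable_mult_right int continuous_on_mult continuous_on_monomial continuous_intros)
      finally show ?thesis .
    qed
    moreover have "continuous_on UNIV (\<lambda>v. f v * q v)"
      by (rule continuous_on_mult[OF linear_continuous_on[OF linear.hyps] q(1)])
    ultimately show ?case by (simp add: good_def q del: monomial_simps)
  next
    case (const c)
    then have "good q" by simp
    then show ?case by (auto simp: good_def mult.assoc mult.left_commute[of _ c] intro!: continuous_intros)
  next
    case (add f g)
    then have f: "good (\<lambda>v. f v * q v)" and g: "good (\<lambda>v. g v * q v)" by auto
    have "(\<integral>v. h v * ((f v + g v) * q v * monomial w v) \<partial>spherical_measure) = 0" for w
    proof -
      have "integrable spherical_measure (\<lambda>v. h v * (f v * q v * monomial w v))"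
        "integrable spherical_measure (\<lambda>v. h v * (g v * q v * monomial w v))"
        using f g by (auto simp: good_def intro!: int continuous_on_mult continuous_on_monomial)
      then have "(\<integral>v. h v * (f v * q v * monomial w v) + h v * (g v * q v * monomial w v) \<partial>spherical_measure) = 0"
        using f g by (simp add: good_def)
      then show ?thesis by (simp add: algebra_simps)
    qed
    moreover have "continuous_on UNIV (\<lambda>v. f v * q v + g v * q v)"
      using f g by (intro continuous_on_add) (auto simp: good_def)
    ultimately show ?case by (simp add: good_def distrib_right)
  next
    case (mult f g)
    then have "good (\<lambda>v. f v * (g v * q v))" by blast
    then show ?case by (simp add: mult.assoc)
  qed
  moreover have "good (\<lambda>_. 1)" using zero by (simp add: good_def)
  ultimately have "good (\<lambda>v. p v * 1)" .
  then show ?thesis by (auto simp: good_def dest: spec[of _ "[]"])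
qed

text \<open>
  Uniform approximation by polynomials, which is the Stone-Weierstrass theorem on the sphere.
\<close>

lemma continuous_moment_zero:
  fixes h :: "real ^ 'd \<Rightarrow> real"
  assumes h: "integrable spherical_measure h"
    and zero: "\<And>w. (\<integral>v. h v * monomial w v \<partial>spherical_measure) = 0"
    and g: "continuous_on UNIV g"
  shows "(\<integral>v. h v * g v \<partial>spherical_measure) = 0"
proof -
  let ?M = "spherical_measure :: (real ^ 'd) measure"
  let ?N = "\<integral>v. \<bar>h v\<bar> \<partial>?M"
  have int: "integrable ?M (\<lambda>v. h v * q v)" if "continuous_on UNIV q" for q :: "real ^ 'd \<Rightarrow> real"
    using integrable_scaleR_continuous[OF h that] by simp
  have "\<bar>\<integral>v. h v * g v \<partial>?M\<bar> \<le> 0 + e" if "e > 0" for e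
  proof -
    have "0 \<le> ?N" by simp
    define d where "d = e / (?N + 1)"
    have N1: "?N + 1 > 0" using \<open>0 \<le> ?N\<close> by linarith
    then have d0: "d > 0" using \<open>e > 0\<close> by (simp add: d_def)
    have "?N * d \<le> (?N + 1) * d" using d0 by (intro mult_right_mono) auto
    also have "\<dots> = e" using N1 by (simp add: d_def)
    finally have d: "d > 0" "?N * d \<le> e" using d0 by auto
    obtain p where p: "real_polynomial_function p" "\<And>v. v \<in> sphere 0 1 \<Longrightarrow> \<bar>g v - p v\<bar> < d"
      using Stone_Weierstrass_real_polynomial_function[of "sphere 0 1" g d] d(1) continuous_on_subset[OF g] by auto
    have pc: "continuous_on UNIV p" by (rule continuous_on_polymonial_function[OF p(1)[unfolded real_polynomial_function_eq]])
    have "(\<integral>v. h v * g v \<partial>?M) = (\<integral>v. h v * g v \<partial>?M) - (\<integral>v. h v * p v \<partial>?M)"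
      by (simp add: polynomial_moment_zero[OF h zero p(1)])
    also have "\<dots> = (\<integral>v. h v * (g v - p v) \<partial>?M)"
      by (simp add: right_diff_distrib int g pc)
    finally have "\<bar>\<integral>v. h v * g v \<partial>?M\<bar> = \<bar>\<integral>v. h v * (g v - p v) \<partial>?M\<bar>" by simp
    also have "\<dots> \<le> (\<integral>v. \<bar>h v\<bar> * d \<partial>?M)"
    proof (rule order_trans[OF integral_abs_bound integral_mono])
      show "integrable ?M (\<lambda>v. \<bar>h v * (g v - p v)\<bar>)"
        by (intro integrable_abs int continuous_intros g pc)
      show "integrable ?M (\<lambda>v. \<bar>h v\<bar> * d)" using h by simp
      fix v assume "v \<in> space ?M"
      then have "\<bar>g v - p v\<bar> \<le> d" using p(2)[of v] by simp
      then show "\<bar>h v * (g v - p v)\<bar> \<le> \<bar>h v\<bar> * d" by (simp add: abs_mult mult_left_mono)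
    qed
    also have "\<dots> \<le> 0 + e" using d(2) by simp
    finally show ?thesis .
  qed
  then have "\<bar>\<integral>v. h v * g v \<partial>?M\<bar> \<le> 0" by (rule field_le_epsilon)
  then show ?thesis by simp
qed

text \<open>
  The indicator function of a closed set is a bounded pointwise limit of continuous functions.
\<close>

lemma closed_set_integral_zero:
  fixes h :: "real ^ 'd \<Rightarrow> real"
  assumes h: "integrable spherical_measure h"
    and zero: "\<And>w. (\<integral>v. h v * monomial w v \<partial>spherical_measure) = 0"
    and C: "closed C"
  shows "(\<integral>v. h v * indicator C v \<partial>spherical_measure) = 0"
proof (cases "C = {}")
  case False
  let ?M = "spherical_measure :: (real ^ 'd) measure"
  define g where "g n v = max 0 (1 - real n * infdist v C)" for n v
  have gc: "continuous_on UNIV (g n)" for n unfolding g_def by (intro continuous_intros)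
  have "(\<lambda>n. \<integral>v. h v * g n v \<partial>?M) \<longlonglongrightarrow> (\<integral>v. h v * indicator C v \<partial>?M)"
  proof (rule integral_dominated_convergence)
    show "(\<lambda>v. h v * indicator C v) \<in> borel_measurable ?M"
      using borel_measurable_integrable[OF h] borel_measurable_spherical[of "indicator C"] C
      by (intro borel_measurable_times) (auto intro!: borel_measurable_indicator borel_closed)
    show "(\<lambda>v. h v * g n v) \<in> borel_measurable ?M" for n
      using integrable_scaleR_continuous[OF h gc] by auto
    show "integrable ?M (\<lambda>v. \<bar>h v\<bar>)" using h by simp
    show "AE v in ?M. (\<lambda>n. h v * g n v) \<longlonglongrightarrow> h v * indicator C v"
    proof (intro AE_I2 tendsto_mult tendsto_const)
      fix v :: "real ^ 'd"
      show "(\<lambda>n. g n v) \<longlonglongrightarrow> indicator C v"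
      proof (cases "v \<in> C")
        case True then show ?thesis by (simp add: g_def)
      next
        case v: False
        then have pos: "infdist v C > 0"
          using in_closed_iff_infdist_zero[OF C False] infdist_nonneg[of v C] by force
        obtain N where N: "1 / infdist v C < real N" using reals_Archimedean2 by blast
        have "g n v = 0" if "n \<ge> N" for n
        proof -
          have "1 / infdist v C \<le> real n" using N that by linarith
          then show ?thesis using pos by (simp add: g_def field_simps)
        qed
        then have "eventually (\<lambda>n. g n v = 0) sequentially" by (auto simp: eventually_sequentially)
        then show ?thesis using v by (simp add: tendsto_eventually)
      qed
    qed
    show "AE v in ?M. norm (h v * g n v) \<le> \<bar>h v\<bar>" for n
    proof (intro AE_I2)
      fix v
      have "\<bar>g n v\<bar> \<le> 1" using infdist_nonneg[of v C] by (auto simp: g_def)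
      then show "norm (h v * g n v) \<le> \<bar>h v\<bar>" by (simp add: abs_mult mult_left_le)
    qed
  qed
  then show ?thesis by (simp add: continuous_moment_zero[OF h zero gc] LIMSEQ_const_iff)
qed simp

text \<open>
  The closed sets generate the Borel sets and are stable under intersection, so the integral of \<open>h\<close>
  vanishes over every Borel set.
\<close>

lemma AE_zero_if_moments_zero:
  fixes h :: "real ^ 'd \<Rightarrow> real"
  assumes h: "integrable spherical_measure h"
    and zero: "\<And>w. (\<integral>v. h v * monomial w v \<partial>spherical_measure) = 0"
  shows "AE v in spherical_measure. h v = 0"
proof (rule density_unique_real[OF h])
  let ?M = "spherical_measure :: (real ^ 'd) measure"
  have hm: "h \<in> borel_measurable ?M" using h by simp
  have meas: "sphere 0 1 \<inter> B \<in> sets ?M" if "B \<in> sets borel" for B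
    using that by (auto simp: sets_spherical_measure sets_restrict_space)
  have int: "set_integrable ?M (sphere 0 1 \<inter> B) h" if "B \<in> sets borel" for B
    unfolding set_integrable_def by (rule integrable_mult_indicator[OF meas[OF that] h])
  have closed: "(LINT v:sphere 0 1 \<inter> C|?M. h v) = 0" if "closed C" for C
  proof -
    have "(LINT v:sphere 0 1 \<inter> C|?M. h v) = (\<integral>v. h v * indicator C v \<partial>?M)"
      unfolding set_lebesgue_integral_def
      by (intro Bochner_Integration.integral_cong) (auto simp: indicator_def)
    then show ?thesis by (simp add: closed_set_integral_zero[OF h zero that])
  qed
  have borel: "(LINT v:sphere 0 1 \<inter> B|?M. h v) = 0" if B: "B \<in> sets borel" for B
  proof -
    have eq: "sets borel = sigma_sets UNIV {C :: (real ^ 'd) set. closed C}"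
      unfolding borel_eq_closed by (rule sets_measure_of) simp
    have "Int_stable {C :: (real ^ 'd) set. closed C}" by (auto simp: Int_stable_def)
    moreover have "{C :: (real ^ 'd) set. closed C} \<subseteq> Pow UNIV" by simp
    moreover have "B \<in> sigma_sets UNIV {C. closed C}" using B eq by simp
    ultimately show ?thesis
    proof (induction rule: sigma_sets_induct_disjoint)
      case (basic A) then show ?case using closed by simp
    next
      case empty show ?case by (simp add: set_lebesgue_integral_def)
    next
      case (compl A)
      then have A: "A \<in> sets borel" by (simp add: eq)
      have "(LINT v:(sphere 0 1 \<inter> A) \<union> (sphere 0 1 \<inter> (UNIV - A))|?M. h v)
          = (LINT v:sphere 0 1 \<inter> A|?M. h v) + (LINT v:sphere 0 1 \<inter> (UNIV - A)|?M. h v)"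
        using A by (intro set_integral_Un int) auto
      moreover have "(sphere 0 1 \<inter> A) \<union> (sphere 0 1 \<inter> (UNIV - A)) = sphere 0 1 \<inter> UNIV" by auto
      ultimately show ?case using closed[of UNIV] compl.IH by simp
    next
      case (union A)
      then have A: "A i \<in> sets borel" for i by (auto simp: eq)
      have "(LINT v:(\<Union>i. sphere 0 1 \<inter> A i)|?M. h v) = (\<Sum>i. LINT v:sphere 0 1 \<inter> A i|?M. h v)"
      proof (rule lebesgue_integral_countable_add)
        show "sphere 0 1 \<inter> A i \<in> sets ?M" for i by (rule meas[OF A])
        show "(sphere 0 1 \<inter> A i) \<inter> (sphere 0 1 \<inter> A j) = {}" if "i \<noteq> j" for i j
          using union(1) that by (auto simp: disjoint_family_on_def)
        have "set_integrable ?M (sphere 0 1 \<inter> (\<Union>i. A i)) h" using A by (intro int) auto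
        then show "set_integrable ?M (\<Union>i. sphere 0 1 \<inter> A i) h" by simp
      qed
      then show ?case by (simp add: union.IH)
    qed
  qed
  show "integrable ?M (\<lambda>_. 0 :: real)" by simp
  fix A assume "A \<in> sets ?M"
  then obtain B where "B \<in> sets borel" "A = sphere 0 1 \<inter> B"
    by (auto simp: sets_spherical_measure sets_restrict_space)
  then show "(LINT v:A|?M. h v) = (LINT v:A|?M. 0)" using borel by simp
qed

section \<open>Tensor powers of rotations\<close>

abbreviation words :: "nat \<Rightarrow> 'd::finite list set" where
  "words n \<equiv> {w. length w = n}"

lemma finite_words: "finite (words n :: 'd::finite list set)"
  using finite_lists_length_eq[of "UNIV :: 'd set" n] by simp

lemma sum_words_Suc: "(\<Sum>w\<in>words (Suc n). f w) = (\<Sum>k\<in>UNIV. \<Sum>w\<in>words n. f (k # w))"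
proof -
  have eq: "words (Suc n) = (\<lambda>(k, w). k # w) ` (UNIV \<times> words n)"
    by (auto simp: length_Suc_conv image_iff)
  have "inj_on (\<lambda>(k, w). k # w) (UNIV \<times> words n)" by (auto simp: inj_on_def)
  then show ?thesis
    unfolding eq by (subst sum.reindex) (simp_all add: sum.cartesian_product split_def)
qed

text \<open>
  The matrix of \<open>g\<^bsup>\<otimes>n\<^esup>\<close> for words of equal length \<open>n\<close>; the last equation is meant for two
  empty words, and its value on words of different lengths is arbitrary.
\<close>

fun tensor_power :: "real ^ 'd ^ 'd \<Rightarrow> 'd list \<Rightarrow> 'd list \<Rightarrow> real" where
  "tensor_power g (a # w) (b # w') = g $ a $ b * tensor_power g w w'"
| "tensor_power g _ _ = 1"

lemma monomial_mult_vec: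
  "monomial w (g *v v) = (\<Sum>w'\<in>words (length w). tensor_power g w w' * monomial w' v)"
proof (induction w)
  case (Cons a w)
  have "monomial (a # w) (g *v v)
      = (\<Sum>b\<in>UNIV. g $ a $ b * v $ b) * (\<Sum>w'\<in>words (length w). tensor_power g w w' * monomial w' v)"
    unfolding monomial_simps Cons by (simp add: matrix_vector_mult_def)
  also have "\<dots> = (\<Sum>w'\<in>words (length (a # w)). tensor_power g (a # w) w' * monomial w' v)"
    by (simp add: sum_words_Suc sum_product mult_ac)
  finally show ?case .
qed simp

definition tensor_act :: "nat \<Rightarrow> real ^ 'd ^ 'd \<Rightarrow> ('d list \<Rightarrow> real) \<Rightarrow> 'd list \<Rightarrow> real" where
  "tensor_act n g m w = (\<Sum>w'\<in>words n. tensor_power g w w' * m w')"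

text \<open>
  Splitting off the first letter writes the tensor power of order \<open>n + 1\<close> as the tensor power of order
  \<open>n\<close>, applied to slices that have been mixed by the orthogonal matrix \<open>g\<close>.
\<close>

lemma tensor_act_isometry:
  fixes g :: "real ^ 'd ^ 'd"
  assumes g: "g \<in> SO"
  shows "L2_set (tensor_act n g m) (words n) = L2_set m (words n)"
proof -
  have "(\<Sum>w\<in>words n. (tensor_act n g m w)\<^sup>2) = (\<Sum>w\<in>words n. (m w)\<^sup>2)"
  proof (induction n arbitrary: m)
    case 0
    have "words 0 = {[] :: 'd list}" by auto
    then show ?case by (simp add: tensor_act_def)
  next
    case (Suc n)
    define m' where "m' a w = (\<Sum>b\<in>UNIV. g $ a $ b * m (b # w))" for a w
    have "tensor_act (Suc n) g m (a # w) = tensor_act n g (m' a) w" for a w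
    proof -
      have "tensor_act (Suc n) g m (a # w)
          = (\<Sum>b\<in>UNIV. \<Sum>w'\<in>words n. tensor_power g w w' * (g $ a $ b * m (b # w')))"
        by (simp add: tensor_act_def sum_words_Suc mult_ac)
      also have "\<dots> = (\<Sum>w'\<in>words n. \<Sum>b\<in>UNIV. tensor_power g w w' * (g $ a $ b * m (b # w')))"
        by (rule sum.swap)
      finally show ?thesis by (simp add: tensor_act_def m'_def sum_distrib_left)
    qed
    then have "(\<Sum>w\<in>words (Suc n). (tensor_act (Suc n) g m w)\<^sup>2) = (\<Sum>a\<in>UNIV. \<Sum>w\<in>words n. (m' a w)\<^sup>2)"
      by (simp add: sum_words_Suc Suc)
    also have "\<dots> = (\<Sum>w\<in>words n. \<Sum>a\<in>UNIV. (m' a w)\<^sup>2)" by (rule sum.swap)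
    also have "\<dots> = (\<Sum>w\<in>words n. \<Sum>b\<in>UNIV. (m (b # w))\<^sup>2)"
    proof (rule sum.cong[OF refl])
      fix w
      define x where "x = (\<chi> b. m (b # w))"
      have "(\<Sum>a\<in>UNIV. (m' a w)\<^sup>2) = (g *v x) \<bullet> (g *v x)"
        by (simp add: inner_vec_def m'_def x_def matrix_vector_mult_def power2_eq_square)
      also have "\<dots> = x \<bullet> x" by (rule SO_inner[OF g])
      also have "\<dots> = (\<Sum>b\<in>UNIV. (m (b # w))\<^sup>2)"
        by (simp add: inner_vec_def x_def power2_eq_square)
      finally show "(\<Sum>a\<in>UNIV. (m' a w)\<^sup>2) = (\<Sum>b\<in>UNIV. (m (b # w))\<^sup>2)" .
    qed
    also have "\<dots> = (\<Sum>w\<in>words (Suc n). (m w)\<^sup>2)"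
      unfolding sum_words_Suc by (rule sum.swap)
    finally show ?case .
  qed
  then show ?thesis by (simp add: L2_set_def)
qed

lemma L2_set_sum_le: "finite J \<Longrightarrow> L2_set (\<lambda>w. \<Sum>i\<in>J. f i w) A \<le> (\<Sum>i\<in>J. L2_set (f i) A)"
proof (induction J rule: finite_induct)
  case empty show ?case by (simp add: L2_set_def)
next
  case (insert i J)
  then show ?case
    using L2_set_triangle_ineq[of "f i" "\<lambda>w. \<Sum>i\<in>J. f i w" A] by simp
qed

text \<open>
  If the sum annihilates \<open>m\<close>, then \<open>k\<close> times an isometry applied to \<open>m\<close> equals the negative of a sum of
  \<open>r - k\<close> isometries applied to \<open>m\<close>.  Comparing norms gives \<open>k \<parallel>m\<parallel> \<le> (r - k) \<parallel>m\<parallel>\<close>, which forces \<open>m = 0\<close> as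
  \<open>k > r - k\<close>.
\<close>

lemma sum_tensor_act_injective:
  fixes \<gamma> :: "nat \<Rightarrow> real ^ 'd ^ 'd"
  assumes \<gamma>: "\<And>i. i \<in> {1..r} \<Longrightarrow> \<gamma> i \<in> SO"
    and eq: "\<And>i. i \<in> {1..k} \<Longrightarrow> \<gamma> i = \<beta>" and k: "0 < k" "k \<le> r" "r < 2 * k"
    and zero: "\<And>w. w \<in> words n \<Longrightarrow> (\<Sum>i=1..r. tensor_act n (\<gamma> i) m w) = 0"
    and w: "w \<in> words n"
  shows "m w = 0"
proof -
  let ?N = "L2_set m (words n)"
  have \<beta>: "\<beta> \<in> SO" using \<gamma>[of 1] eq[of 1] k by simp
  have split: "{1..r} = {1..k} \<union> {k<..r}" "{1..k} \<inter> {k<..r} = {}" using k by auto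
  have s: "(\<Sum>i=1..r. tensor_act n (\<gamma> i) m w) = real k * tensor_act n \<beta> m w + (\<Sum>i\<in>{k<..r}. tensor_act n (\<gamma> i) m w)" for w
    unfolding split(1) by (subst sum.union_disjoint) (use split(2) eq in auto)
  have "real k * ?N = L2_set (\<lambda>w. real k * tensor_act n \<beta> m w) (words n)"
    by (simp add: L2_set_right_distrib[symmetric] tensor_act_isometry[OF \<beta>])
  also have "\<dots> = L2_set (\<lambda>w. - (\<Sum>i\<in>{k<..r}. tensor_act n (\<gamma> i) m w)) (words n)"
    by (rule L2_set_cong[OF refl]) (use zero s in \<open>auto simp: eq_neg_iff_add_eq_0\<close>)
  also have "\<dots> = L2_set (\<lambda>w. \<Sum>i\<in>{k<..r}. tensor_act n (\<gamma> i) m w) (words n)"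
    by (simp add: L2_set_def)
  also have "\<dots> \<le> (\<Sum>i\<in>{k<..r}. L2_set (tensor_act n (\<gamma> i) m) (words n))"
    by (rule L2_set_sum_le) simp
  also have "\<dots> = (\<Sum>i\<in>{k<..r}. ?N)"
    using \<gamma> by (intro sum.cong refl tensor_act_isometry) auto
  also have "\<dots> = real (r - k) * ?N" by simp
  finally have le: "real k * ?N \<le> real (r - k) * ?N" .
  have "?N = 0"
  proof (rule ccontr)
    assume "?N \<noteq> 0"
    then have "?N > 0" using L2_set_nonneg[of m "words n"] by linarith
    with le have "k \<le> r - k" by simp
    with k show False by linarith
  qed
  then show "m w = 0" using w by (simp add: L2_set_eq_0_iff finite_words)
qed

text \<open>
  The polynomial is the determinant, with respect to an enumeration of the finite index set \<open>W\<close>.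
\<close>

lemma ex_entry_poly_singular:
  fixes A :: "(nat \<Rightarrow> real ^ 'd ^ 'd) \<Rightarrow> 'w \<Rightarrow> 'w \<Rightarrow> real"
  assumes "finite W" and A: "\<And>w w'. entry_poly I (\<lambda>x. A x w w')"
  shows "\<exists>F. entry_poly I F \<and> (\<forall>x. F x = 0 \<longleftrightarrow>
    (\<exists>m. (\<exists>w\<in>W. m w \<noteq> 0) \<and> (\<forall>w\<in>W. (\<Sum>w'\<in>W. A x w w' * m w') = 0)))"
proof -
  obtain ws where ws: "set ws = W" "distinct ws" using finite_distinct_list[OF \<open>finite W\<close>] by blast
  let ?N = "length ws"
  define B where "B x = Matrix.mat ?N ?N (\<lambda>(i, j). A x (ws ! i) (ws ! j))" for x
  define F where "F x = Determinant.det (B x)" for x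
  have bij: "bij_betw (\<lambda>i. ws ! i) {0..<?N} W"
    using bij_betw_nth[OF ws(2), of "{0..<?N}" W] ws(1) by (simp add: atLeast0LessThan)
  have B: "B x \<in> carrier_mat ?N ?N" for x by (simp add: B_def)
  have "F = (\<lambda>x. \<Sum>p\<in>{p. p permutes {0..<?N}}. signof p * (\<Prod>i\<in>{0..<?N}. A x (ws ! i) (ws ! p i)))"
    unfolding F_def det_def'[OF B]
    by (intro ext sum.cong prod.cong arg_cong2[where f = "(*)"] refl)
       (use permutes_in_image in \<open>fastforce simp: B_def\<close>)
  then have "entry_poly I F"
    by (auto intro!: entry_poly_sum entry_poly.mult entry_poly_prod A entry_poly.const)
  moreover have "F x = 0 \<longleftrightarrow> (\<exists>m. (\<exists>w\<in>W. m w \<noteq> 0) \<and> (\<forall>w\<in>W. (\<Sum>w'\<in>W. A x w w' * m w') = 0))" for x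
  proof -
    have row: "vec_index (B x *\<^sub>v v) i = (\<Sum>j\<in>{0..<?N}. A x (ws ! i) (ws ! j) * vec_index v j)"
      if "v \<in> carrier_vec ?N" "i < ?N" for v i
      using that by (simp add: B_def scalar_prod_def)
    have "F x = 0 \<longleftrightarrow> (\<exists>v. v \<in> carrier_vec ?N \<and> v \<noteq> 0\<^sub>v ?N \<and> B x *\<^sub>v v = 0\<^sub>v ?N)"
      unfolding F_def by (rule det_0_iff_vec_prod_zero[OF B])
    also have "\<dots> \<longleftrightarrow> (\<exists>m. (\<exists>w\<in>W. m w \<noteq> 0) \<and> (\<forall>w\<in>W. (\<Sum>w'\<in>W. A x w w' * m w') = 0))"
    proof safe
      fix v assume v: "v \<in> carrier_vec ?N" "v \<noteq> 0\<^sub>v ?N" "B x *\<^sub>v v = 0\<^sub>v ?N"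
      define m where "m w = vec_index v (inv_into {0..<?N} (\<lambda>i. ws ! i) w)" for w
      have m: "m (ws ! i) = vec_index v i" if "i < ?N" for i
        using bij_betw_inv_into_left[OF bij, of i] that by (simp add: m_def)
      obtain i where i: "i < ?N" "vec_index v i \<noteq> 0" using v(1,2) by (auto simp: Matrix.vec_eq_iff)
      have "(\<Sum>w'\<in>W. A x (ws ! i) w' * m w') = 0" if "i < ?N" for i
      proof -
        have "(\<Sum>w'\<in>W. A x (ws ! i) w' * m w') = (\<Sum>j\<in>{0..<?N}. A x (ws ! i) (ws ! j) * m (ws ! j))"
          by (rule sum.reindex_bij_betw[OF bij, symmetric])
        also have "\<dots> = vec_index (B x *\<^sub>v v) i" by (simp add: row[OF v(1) that] m)
        finally show ?thesis using v(3) that by simp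
      qed
      then have "\<forall>w\<in>W. (\<Sum>w'\<in>W. A x w w' * m w') = 0"
        using ws(1) by (metis in_set_conv_nth)
      moreover have "\<exists>w\<in>W. m w \<noteq> 0" using m[OF i(1)] i ws(1) by (metis nth_mem)
      ultimately show "\<exists>m. (\<exists>w\<in>W. m w \<noteq> 0) \<and> (\<forall>w\<in>W. (\<Sum>w'\<in>W. A x w w' * m w') = 0)" by blast
    next
      fix m w assume w: "w \<in> W" "m w \<noteq> 0" and eq: "\<forall>w\<in>W. (\<Sum>w'\<in>W. A x w w' * m w') = 0"
      define v where "v = Matrix.vec ?N (\<lambda>i. m (ws ! i))"
      have v: "v \<in> carrier_vec ?N" by (simp add: v_def)
      obtain i where i: "i < ?N" "w = ws ! i" using w(1) ws(1) by (metis in_set_conv_nth)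
      have "vec_index v i \<noteq> 0" using i w(2) by (simp add: v_def)
      then have "v \<noteq> 0\<^sub>v ?N" using i(1) by auto
      moreover have "B x *\<^sub>v v = 0\<^sub>v ?N"
      proof (rule eq_vecI)
        fix i assume "i < dim_vec (0\<^sub>v ?N :: real Matrix.vec)"
        then have i: "i < ?N" by simp
        have "vec_index (B x *\<^sub>v v) i = (\<Sum>j\<in>{0..<?N}. A x (ws ! i) (ws ! j) * m (ws ! j))"
          by (simp add: row[OF v i]) (simp add: v_def)
        also have "\<dots> = (\<Sum>w'\<in>W. A x (ws ! i) w' * m w')"
          by (rule sum.reindex_bij_betw[OF bij])
        also have "\<dots> = 0" using eq i ws(1) by auto
        finally show "vec_index (B x *\<^sub>v v) i = vec_index (0\<^sub>v ?N) i" using i by simp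
      qed (simp add: B_def)
      ultimately show "\<exists>v. v \<in> carrier_vec ?N \<and> v \<noteq> 0\<^sub>v ?N \<and> B x *\<^sub>v v = 0\<^sub>v ?N" using v by blast
    qed
    finally show ?thesis .
  qed
  ultimately show ?thesis by (intro exI[of _ F] conjI allI)
qed

section \<open>Sections of the dividing tuples\<close>

text \<open>
  Take \<open>h = f - 1/r\<close>; it is integrable because the measure is finite.
\<close>

lemma fractionally_dividesE:
  fixes \<gamma> :: "nat \<Rightarrow> real ^ 'd ^ 'd"
  assumes "fractionally_divides r \<gamma>" and \<gamma>: "\<And>i. i \<in> {1..r} \<Longrightarrow> \<gamma> i \<in> SO" and r: "r > 0"
  obtains h :: "real ^ 'd \<Rightarrow> real" where "integrable spherical_measure h"
    "AE v in spherical_measure. (\<Sum>i=1..r. act (\<gamma> i) h v) = 0"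
    "\<not> (AE v in spherical_measure. h v = 0)"
proof -
  let ?M = "spherical_measure :: (real ^ 'd) measure"
  obtain f where f: "f \<in> L2 ?M" "AE v in ?M. (\<Sum>i=1..r. act (\<gamma> i) f v) = 1"
    "emeasure ?M {v \<in> space ?M. f v \<noteq> 1 / real r} > 0"
    using assms(1) unfolding fractionally_divides_def by blast
  interpret finite_measure ?M by (rule finite_spherical_measure[OF \<gamma> f(1,2)])
  have fm[measurable]: "f \<in> borel_measurable ?M" and f2: "integrable ?M (\<lambda>v. (f v)\<^sup>2)"
    using f(1) by (simp_all add: L2_def)
  show ?thesis
  proof (rule that[of "\<lambda>v. f v - 1 / real r"])
    have "integrable ?M f"
      by (rule square_integrable_imp_integrable[OF fm f2])
    then show "integrable ?M (\<lambda>v. f v - 1 / real r)" by simp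
    show "AE v in ?M. (\<Sum>i=1..r. act (\<gamma> i) (\<lambda>v. f v - 1 / real r) v) = 0"
      using f(2) by eventually_elim (use r in \<open>simp add: act_def sum_subtractf\<close>)
    show "\<not> (AE v in ?M. f v - 1 / real r = 0)"
    proof
      assume "AE v in ?M. f v - 1 / real r = 0"
      moreover have "{v \<in> space ?M. f v \<noteq> 1 / real r} \<in> sets ?M" by measurable
      ultimately have "emeasure ?M {v \<in> space ?M. f v \<noteq> 1 / real r} = 0"
        by (subst (asm) AE_iff_measurable) auto
      with f(3) show False by simp
    qed
  qed
qed

lemma merge_in_SO:
  assumes "\<alpha> \<in> SO_tuples {1..l}" "\<gamma>' \<in> SO_tuples {l + 1..r}" "i \<in> {1..r}"
  shows "merge {1..l} {l + 1..r} (\<alpha>, \<gamma>') i \<in> SO"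
  using assms by (auto simp: merge_def SO_tuples_def)

lemma dividing_sectionE:
  fixes \<gamma>' :: "nat \<Rightarrow> real ^ 'd ^ 'd"
  assumes "\<alpha> \<in> dividing_section r l \<gamma>'" and "\<gamma>' \<in> SO_tuples {l + 1..r}" and "r > 0"
  obtains h :: "real ^ 'd \<Rightarrow> real" where "integrable spherical_measure h"
    "AE v in spherical_measure. (\<Sum>i=1..r. act (merge {1..l} {l + 1..r} (\<alpha>, \<gamma>') i) h v) = 0"
    "\<not> (AE v in spherical_measure. h v = 0)"
proof -
  have \<alpha>: "\<alpha> \<in> SO_tuples {1..l}" "fractionally_divides r (merge {1..l} {l + 1..r} (\<alpha>, \<gamma>'))"
    using assms(1) by (auto simp: dividing_section_def dividing_tuples_def)
  from fractionally_dividesE[OF \<alpha>(2) merge_in_SO[OF \<alpha>(1) assms(2)] \<open>r > 0\<close>] that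
  show ?thesis by blast
qed

lemma merge_apply:
  "merge {1..l} {l + 1..r} (\<alpha>, \<gamma>') i = (if i \<in> {1..l} then \<alpha> i else if i \<in> {l + 1..r} then \<gamma>' i else undefined)"
  by (auto simp: merge_def)

lemma entry_poly_merge:
  assumes "\<And>i. i \<in> I \<Longrightarrow> entry_poly I (\<lambda>x. F (x i))"
  shows "entry_poly I (\<lambda>x. F (merge I J (x, y) i))"
  using assms by (cases "i \<in> I") (auto simp: merge_def intro: entry_poly.const)

lemma entry_poly_tensor_power:
  "i \<in> I \<Longrightarrow> entry_poly I (\<lambda>x. tensor_power (x i) w w')"
proof (induction w arbitrary: w')
  case Nil show ?case by (simp add: entry_poly.const)
next
  case (Cons a w)
  then show ?case by (cases w') (auto intro: entry_poly.intros)
qed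

lemma tensor_act_moments:
  fixes h :: "real ^ 'd \<Rightarrow> real"
  assumes h: "integrable spherical_measure h" and w: "w \<in> words n"
  shows "tensor_act n g (\<lambda>w. \<integral>v. h v * monomial w v \<partial>spherical_measure) w
    = (\<integral>v. h v *\<^sub>R monomial w (g *v v) \<partial>spherical_measure)"
proof -
  have i: "integrable spherical_measure (\<lambda>v. h v * monomial w' v)" for w'
    using integrable_scaleR_continuous[OF h continuous_on_monomial] by simp
  have "(\<integral>v. h v *\<^sub>R monomial w (g *v v) \<partial>spherical_measure)
    = (\<integral>v. (\<Sum>w'\<in>words n. tensor_power g w w' * (h v * monomial w' v)) \<partial>spherical_measure)"
    using w by (simp add: monomial_mult_vec sum_distrib_left mult_ac)
  also have "\<dots> = (\<Sum>w'\<in>words n. \<integral>v. tensor_power g w w' * (h v * monomial w' v) \<partial>spherical_measure)"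
    by (rule Bochner_Integration.integral_sum) (rule integrable_mult_right[OF i])
  finally show ?thesis by (simp add: tensor_act_def)
qed

lemma ex_entry_poly_tensor_singular:
  fixes \<gamma>' :: "nat \<Rightarrow> real ^ 'd ^ 'd"
  shows "\<exists>F. entry_poly {1..l} F \<and> (\<forall>\<alpha>. F \<alpha> = 0 \<longleftrightarrow> (\<exists>m. (\<exists>w\<in>words n. m w \<noteq> 0) \<and>
    (\<forall>w\<in>words n. (\<Sum>i=1..r. tensor_act n (merge {1..l} {l + 1..r} (\<alpha>, \<gamma>') i) m w) = 0)))"
proof -
  let ?g = "\<lambda>\<alpha>. merge {1..l} {l + 1..r} (\<alpha>, \<gamma>')"
  let ?A = "\<lambda>\<alpha> w w'. \<Sum>i=1..r. tensor_power (?g \<alpha> i) w w'"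
  have A: "entry_poly {1..l} (\<lambda>\<alpha>. ?A \<alpha> w w')" for w w' :: "'d list"
  proof (rule entry_poly_sum)
    fix i show "entry_poly {1..l} (\<lambda>\<alpha>. tensor_power (?g \<alpha> i) w w')"
      by (rule entry_poly_merge[where F = "\<lambda>g. tensor_power g w w'"]) (rule entry_poly_tensor_power)
  qed
  have act: "(\<Sum>w'\<in>words n. ?A \<alpha> w w' * m w') = (\<Sum>i=1..r. tensor_act n (?g \<alpha> i) m w)" for \<alpha> m and w :: "'d list"
    unfolding tensor_act_def sum_distrib_right by (rule sum.swap)
  show ?thesis
    using ex_entry_poly_singular[where A = ?A and W = "words n", OF finite_words A] by (simp only: act)
qed

text \<open>
  The polynomial of degree \<open>n\<close> is nonzero at the tuple whose entries all equal the first fixed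
  rotation: then \<open>l + 1\<close> of the \<open>r \<le> 2 l + 1\<close> rotations coincide.
\<close>

lemma dividing_section_negligible_half:
  fixes \<gamma>' :: "nat \<Rightarrow> real ^ 'd ^ 'd"
  assumes l: "l < r" "r \<le> 2 * l + 1" and \<gamma>': "\<gamma>' \<in> SO_tuples {l + 1..r}"
  shows "meager_in (SO_power_top {1..l}) (dividing_section r l \<gamma>') \<and>
    haar_null (SO_power {1..l}) (SO_power_top {1..l}) (dividing_section r l \<gamma>')"
proof -
  let ?g = "\<lambda>\<alpha>. merge {1..l} {l + 1..r} (\<alpha>, \<gamma>')"
  let ?singular = "\<lambda>n \<alpha>. \<exists>m. (\<exists>w\<in>words n. m w \<noteq> 0) \<and> (\<forall>w\<in>words n. (\<Sum>i=1..r. tensor_act n (?g \<alpha> i) m w) = 0)"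
  have "\<forall>n. \<exists>F. entry_poly {1..l} F \<and> (\<forall>\<alpha>. F \<alpha> = 0 \<longleftrightarrow> ?singular n \<alpha>)"
    by (rule allI, rule ex_entry_poly_tensor_singular)
  from choice[OF this] obtain F where
    F_all: "\<forall>n. entry_poly {1..l} (F n) \<and> (\<forall>\<alpha>. F n \<alpha> = 0 \<longleftrightarrow> ?singular n \<alpha>)" ..
  have F: "entry_poly {1..l} (F n)" for n
    by (rule F_all[THEN spec, THEN conjunct1])
  have F0: "F n \<alpha> = 0 \<longleftrightarrow> ?singular n \<alpha>" for n \<alpha>
    by (rule F_all[THEN spec, THEN conjunct2, THEN spec])
  show ?thesis
  proof (rule meager_and_haar_null_if_covered_by_zero_sets[where F = F])
    fix n
    let ?\<beta> = "\<gamma>' (l + 1)"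
    let ?y = "\<lambda>i\<in>{1..l}. ?\<beta>"
    have \<beta>: "?\<beta> \<in> SO" using \<gamma>' l by (intro SO_tuplesD) auto
    then have y: "?y \<in> SO_tuples {1..l}" by (simp add: SO_tuples_def)
    have gy: "?g ?y i = ?\<beta>" if "i \<in> {1..l + 1}" for i
    proof (cases "i = l + 1")
      case True
      then show ?thesis using l(1) by (simp add: merge_apply)
    next
      case False
      with that have "i \<in> {1..l}" by auto
      then show ?thesis by (simp add: merge_apply)
    qed
    have "m w = 0" if zero: "\<forall>w\<in>words n. (\<Sum>i=1..r. tensor_act n (?g ?y i) m w) = 0" and w: "w \<in> words n" for m w
    proof (rule sum_tensor_act_injective[where \<gamma> = "?g ?y" and k = "l + 1"])
      show "?g ?y i \<in> SO" if "i \<in> {1..r}" for i by (rule merge_in_SO[OF y \<gamma>' that])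
      show "?g ?y i = ?\<beta>" if "i \<in> {1..l + 1}" for i by (rule gy[OF that])
      show "(\<Sum>i=1..r. tensor_act n (?g ?y i) m w) = 0" if "w \<in> words n" for w by (rule bspec[OF zero that])
      show "w \<in> words n" by (rule w)
    qed (use l in simp_all)
    then have "F n ?y \<noteq> 0" unfolding F0 by blast
    with y show "\<exists>y\<in>SO_tuples {1..l}. F n y \<noteq> 0" by blast
  next
    fix \<alpha> assume \<alpha>: "\<alpha> \<in> dividing_section r l \<gamma>'"
    then obtain h :: "real ^ 'd \<Rightarrow> real" where h: "integrable spherical_measure h"
      "AE v in spherical_measure. (\<Sum>i=1..r. act (?g \<alpha> i) h v) = 0"
      "\<not> (AE v in spherical_measure. h v = 0)"
      using dividing_sectionE[OF \<alpha> \<gamma>'] l by auto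
    have SO: "?g \<alpha> i \<in> SO" if "i \<in> {1..r}" for i
      using \<alpha> merge_in_SO[OF _ \<gamma>' that] by (auto simp: dividing_section_def)
    define m where "m w = (\<integral>v. h v * monomial w v \<partial>spherical_measure)" for w
    obtain w where w: "m w \<noteq> 0"
      using AE_zero_if_moments_zero[OF h(1)] h(3) unfolding m_def by blast
    have "(\<Sum>i=1..r. tensor_act n (?g \<alpha> i) m w) = 0" if "w \<in> words n" for n w
      unfolding m_def tensor_act_moments[OF h(1) that]
      by (rule moment_relation[OF SO h(1,2) continuous_on_monomial])
    then have "F (length w) \<alpha> = 0" using w unfolding F0 by blast
    then show "\<exists>n. F n \<alpha> = 0" ..
  qed (simp, rule F, auto simp: dividing_section_def)
qed

section \<open>The circle\<close>

lemma det_two: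
  fixes A :: "real ^ 'd ^ 'd"
  assumes "a \<noteq> b" "UNIV = {a, b :: 'd}"
  shows "det A = A $ a $ a * A $ b $ b - A $ a $ b * A $ b $ a"
proof -
  have f: "finite {b}" "a \<notin> {b}" using assms(1) by auto
  show ?thesis
    unfolding det_def assms(2)
    unfolding sum_over_permutations_insert[OF f]
    unfolding permutes_sing
    using assms(1) by (simp add: sign_swap_id sign_id swap_id_eq)
qed

text \<open>
  Two coordinates \<open>a\<close> and \<open>b\<close> identify the plane with the complex numbers.
\<close>

locale plane =
  fixes a b :: "'d::finite"
  assumes ab: "a \<noteq> b" "UNIV = {a, b}"
begin

definition to_complex :: "real ^ 'd \<Rightarrow> complex" where
  "to_complex v = Complex (v $ a) (v $ b)"

text \<open>
  The complex number by which a rotation of the plane multiplies.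
\<close>

definition phase :: "real ^ 'd ^ 'd \<Rightarrow> complex" where
  "phase g = Complex (g $ a $ a) (g $ b $ a)"

lemma sum_plane: "(\<Sum>k\<in>UNIV. f k) = f a + f b"
  using ab(1) by (simp add: ab(2))

lemma SO_plane_entries:
  assumes "g \<in> SO" shows "g $ b $ b = g $ a $ a" "g $ a $ b = - g $ b $ a"
proof -
  have t: "(transpose g ** g) $ k $ k = 1" for k
    using SO_transpose_mult(1)[OF assms] by (simp add: mat_def)
  have e: "(g $ a $ a)\<^sup>2 + (g $ b $ a)\<^sup>2 = 1" "(g $ a $ b)\<^sup>2 + (g $ b $ b)\<^sup>2 = 1"
    using t[of a] t[of b] by (simp_all add: matrix_matrix_mult_def transpose_def sum_plane power2_eq_square)
  have "g $ a $ a * g $ b $ b - g $ a $ b * g $ b $ a = 1"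
    using assms det_two[OF ab, of g] by (simp add: SO_iff)
  \<comment> \<open>Expanding the squares gives the squared lengths of both columns minus twice the determinant, \<open>1 + 1 - 2\<close>.\<close>
  then have "(g $ b $ b - g $ a $ a)\<^sup>2 + (g $ a $ b + g $ b $ a)\<^sup>2 = 0"
    using e by (simp add: power2_eq_square algebra_simps)
  then show "g $ b $ b = g $ a $ a" "g $ a $ b = - g $ b $ a"
    by (auto simp: sum_power2_eq_zero_iff)
qed

lemma to_complex_mult_vec:
  assumes "g \<in> SO" shows "to_complex (g *v v) = phase g * to_complex v"
  by (simp add: complex_eq_iff to_complex_def phase_def matrix_vector_mult_def sum_plane
      SO_plane_entries[OF assms] algebra_simps)

lemma continuous_on_to_complex: "continuous_on S to_complex"
  unfolding to_complex_def Complex_eq by (intro continuous_intros)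

lemma norm_to_complex: "norm (to_complex v) = norm v"
  by (simp add: to_complex_def cmod_def norm_vec_def L2_set_def sum_plane)

text \<open>
  On the unit circle, \<open>z\<^sup>i z'\<^sup>j\<close> with the conjugate \<open>z'\<close> of \<open>z\<close> is a power of \<open>z\<close> or of \<open>z'\<close>; and since \<open>h\<close> is real, its
  integrals against powers of \<open>z'\<close> are conjugate to those against powers of \<open>z\<close>.  Both coordinates are
  linear combinations of \<open>z\<close> and \<open>z'\<close>, so all moments vanish.
\<close>

lemma AE_zero_if_fourier_coefficients_zero:
  fixes h :: "real ^ 'd \<Rightarrow> real"
  assumes h: "integrable spherical_measure h"
    and zero: "\<And>k. (\<integral>v. h v *\<^sub>R to_complex v ^ k \<partial>spherical_measure) = 0"
  shows "AE v in spherical_measure. h v = 0"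
proof (rule AE_zero_if_moments_zero[OF h])
  let ?M = "spherical_measure :: (real ^ 'd) measure"
  let ?z = to_complex
  have int: "integrable ?M (\<lambda>v. h v *\<^sub>R q v)" if "continuous_on UNIV q" for q :: "real ^ 'd \<Rightarrow> complex"
    by (rule integrable_scaleR_continuous[OF h that])
  have qc: "continuous_on UNIV (\<lambda>v. ?z v ^ i * cnj (?z v) ^ j * complex_of_real (monomial w v))" for i j w
    by (intro continuous_intros continuous_on_to_complex continuous_on_monomial)
  have base: "(\<integral>v. h v *\<^sub>R (?z v ^ i * cnj (?z v) ^ j) \<partial>?M) = 0" for i j
  proof (cases "j \<le> i")
    case True
    have "(\<integral>v. h v *\<^sub>R (?z v ^ i * cnj (?z v) ^ j) \<partial>?M) = (\<integral>v. h v *\<^sub>R ?z v ^ (i - j) \<partial>?M)"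
    proof (rule Bochner_Integration.integral_cong[OF refl])
      fix v assume "v \<in> space ?M"
      then have "?z v * cnj (?z v) = 1" using norm_to_complex[of v] by (simp flip: complex_norm_square)
      then have "?z v ^ j * cnj (?z v) ^ j = 1" by (simp flip: power_mult_distrib)
      then have "?z v ^ (i - j) * (?z v ^ j * cnj (?z v) ^ j) = ?z v ^ (i - j)" by simp
      then show "h v *\<^sub>R (?z v ^ i * cnj (?z v) ^ j) = h v *\<^sub>R ?z v ^ (i - j)"
        using True by (simp add: mult.assoc[symmetric] power_add[symmetric])
    qed
    then show ?thesis using zero by simp
  next
    case False
    have "(\<integral>v. h v *\<^sub>R (?z v ^ i * cnj (?z v) ^ j) \<partial>?M) = (\<integral>v. cnj (h v *\<^sub>R ?z v ^ (j - i)) \<partial>?M)"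
    proof (rule Bochner_Integration.integral_cong[OF refl])
      fix v assume "v \<in> space ?M"
      then have "?z v * cnj (?z v) = 1" using norm_to_complex[of v] by (simp flip: complex_norm_square)
      then have "?z v ^ i * cnj (?z v) ^ i = 1" by (simp flip: power_mult_distrib)
      then have "(?z v ^ i * cnj (?z v) ^ i) * cnj (?z v) ^ (j - i) = cnj (?z v) ^ (j - i)" by simp
      then show "h v *\<^sub>R (?z v ^ i * cnj (?z v) ^ j) = cnj (h v *\<^sub>R ?z v ^ (j - i))"
        using False by (simp add: mult.assoc power_add[symmetric])
    qed
    then show ?thesis using zero[of "j - i"] by (simp only: Bochner_Integration.integral_cnj complex_cnj_zero)
  qed
  have all: "(\<integral>v. h v *\<^sub>R (?z v ^ i * cnj (?z v) ^ j * complex_of_real (monomial w v)) \<partial>?M) = 0" for i j w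
  proof (induction w arbitrary: i j)
    case Nil show ?case using base by simp
  next
    case (Cons k w)
    let ?I = "\<lambda>i j. \<integral>v. h v *\<^sub>R (?z v ^ i * cnj (?z v) ^ j * complex_of_real (monomial w v)) \<partial>?M"
    define \<epsilon> :: complex where "\<epsilon> = (if k = a then 1 / 2 else - \<i> / 2)"
    have k: "complex_of_real (v $ k) = \<epsilon> * ?z v + cnj \<epsilon> * cnj (?z v)" for v
      using ab by (auto simp: \<epsilon>_def to_complex_def complex_eq_iff)
    have "(\<integral>v. h v *\<^sub>R (?z v ^ i * cnj (?z v) ^ j * complex_of_real (monomial (k # w) v)) \<partial>?M)
        = (\<integral>v. \<epsilon> * (h v *\<^sub>R (?z v ^ Suc i * cnj (?z v) ^ j * complex_of_real (monomial w v)))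
           + cnj \<epsilon> * (h v *\<^sub>R (?z v ^ i * cnj (?z v) ^ Suc j * complex_of_real (monomial w v))) \<partial>?M)"
      by (simp add: k scaleR_conv_of_real algebra_simps)
    also have "\<dots> = \<epsilon> * ?I (Suc i) j + cnj \<epsilon> * ?I i (Suc j)"
      by (subst Bochner_Integration.integral_add) (intro integrable_mult_right int qc, intro integrable_mult_right int qc, simp only: integral_mult_right_zero)
    finally show ?case by (simp only: Cons.IH) simp
  qed
  fix w
  have "complex_of_real (\<integral>v. h v * monomial w v \<partial>?M) = (\<integral>v. complex_of_real (h v * monomial w v) \<partial>?M)"
    by (rule integral_complex_of_real[symmetric])
  also have "\<dots> = 0" using all[of 0 0 w] by (simp add: scaleR_conv_of_real)
  finally show "(\<integral>v. h v * monomial w v \<partial>?M) = 0" by simp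
qed

lemma entry_poly_phase_power:
  assumes "i \<in> I"
  shows "entry_poly I (\<lambda>x. Re (phase (x i) ^ k)) \<and> entry_poly I (\<lambda>x. Im (phase (x i) ^ k))"
proof (induction k)
  case 0 show ?case by (simp add: entry_poly.const)
next
  case (Suc k)
  have e: "entry_poly I (\<lambda>x. x i $ a $ a)" "entry_poly I (\<lambda>x. x i $ b $ a)"
    by (rule entry_poly.entry[OF assms])+
  then have neg: "entry_poly I (\<lambda>x. (- 1) * x i $ b $ a)" by (intro entry_poly.mult[OF entry_poly.const])
  have re: "Re (phase g ^ Suc k) = g $ a $ a * Re (phase g ^ k) + ((- 1) * g $ b $ a) * Im (phase g ^ k)"
    and im: "Im (phase g ^ Suc k) = g $ a $ a * Im (phase g ^ k) + g $ b $ a * Re (phase g ^ k)" for g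
    by (simp_all add: phase_def)
  show ?case
    unfolding re im
    by (intro conjI
        entry_poly.add[OF entry_poly.mult[OF e(1) Suc[THEN conjunct1]] entry_poly.mult[OF neg Suc[THEN conjunct2]]]
        entry_poly.add[OF entry_poly.mult[OF e(1) Suc[THEN conjunct2]] entry_poly.mult[OF e(2) Suc[THEN conjunct1]]])
qed

lemma ex_rotation_phase:
  assumes "norm z = 1" obtains g where "g \<in> SO" "phase g = z"
proof -
  define g :: "real ^ 'd ^ 'd" where
    "g = (\<chi> i j. if i = j then Re z else if i = a then - Im z else Im z)"
  have z: "(Re z)\<^sup>2 + (Im z)\<^sup>2 = 1" using assms by (simp add: cmod_def)
  have g: "g $ a $ a = Re z" "g $ b $ b = Re z" "g $ a $ b = - Im z" "g $ b $ a = Im z"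
    using ab(1) by (auto simp: g_def)
  have "(transpose g ** g) $ i $ j = mat 1 $ i $ j" for i j
  proof -
    have "i = a \<or> i = b" "j = a \<or> j = b" using ab(2) by blast+
    then show ?thesis
      by (elim disjE; hypsubst; simp add: matrix_matrix_mult_def transpose_def
        mat_def sum_plane g ab(1) ab(1)[symmetric] mult.commute z[unfolded power2_eq_square]
        z[unfolded power2_eq_square add.commute[of "Re z * Re z"]])
  qed
  then have "transpose g ** g = mat 1"
    unfolding vec_eq_iff by blast
  moreover have "det g = 1"
    using z by (simp add: det_two[OF ab] g power2_eq_square)
  ultimately have "g \<in> SO" by (simp add: SO_iff orthogonal_matrix)
  moreover have "phase g = z" by (simp add: phase_def g complex_eq_iff)
  ultimately show ?thesis by (rule that)
qed

text \<open>
  A dividing tuple makes some power sum of the phases vanish.  For a given exponent \<open>k\<close> only the summand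
  of the free rotation varies, and for \<open>k > 0\<close> it takes both values \<open>1\<close> and \<open>-1\<close>; for \<open>k = 0\<close> the sum is \<open>r\<close>.
\<close>

lemma dividing_section_negligible_plane:
  fixes \<gamma>' :: "nat \<Rightarrow> real ^ 'd ^ 'd"
  assumes r: "r \<ge> 1" and \<gamma>': "\<gamma>' \<in> SO_tuples {1 + 1..r}"
  shows "meager_in (SO_power_top {1..1}) (dividing_section r 1 \<gamma>') \<and>
    haar_null (SO_power {1..1}) (SO_power_top {1..1}) (dividing_section r 1 \<gamma>')"
proof -
  let ?g = "\<lambda>\<alpha>. merge {1..1} {1 + 1..r} (\<alpha>, \<gamma>')"
  define S where "S k \<alpha> = (\<Sum>i=1..r. phase (?g \<alpha> i) ^ k)" for k \<alpha>
  \<comment> \<open>The squared absolute value is a real polynomial with the same zeros as the power sum.\<close>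
  define F where "F k \<alpha> = Re (S k \<alpha>) * Re (S k \<alpha>) + Im (S k \<alpha>) * Im (S k \<alpha>)" for k \<alpha>
  have F0: "F k \<alpha> = 0 \<longleftrightarrow> S k \<alpha> = 0" for k \<alpha>
    by (simp add: F_def complex_eq_iff sum_squares_eq_zero_iff)
  have F: "entry_poly {1..1} (F k)" for k
  proof -
    have "entry_poly {1..1} (\<lambda>\<alpha>. Re (S k \<alpha>))" "entry_poly {1..1} (\<lambda>\<alpha>. Im (S k \<alpha>))"
      unfolding S_def Re_sum Im_sum
      by (intro entry_poly_sum entry_poly_merge[where F = "\<lambda>g. Re (phase g ^ k)"]
            entry_poly_merge[where F = "\<lambda>g. Im (phase g ^ k)"] entry_poly_phase_power[THEN conjunct1]
            entry_poly_phase_power[THEN conjunct2]; assumption)+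
    then show ?thesis unfolding F_def[abs_def] by (intro entry_poly.add entry_poly.mult)
  qed
  show ?thesis
  proof (rule meager_and_haar_null_if_covered_by_zero_sets[where F = F])
    fix k
    have S_eq: "S k \<alpha> = phase (\<alpha> 1) ^ k + (\<Sum>i\<in>{1 + 1..r}. phase (\<gamma>' i) ^ k)" for \<alpha>
    proof -
      have "{1..r} = insert 1 {1 + 1..r}" using r by auto
      then have "S k \<alpha> = phase (?g \<alpha> 1) ^ k + (\<Sum>i\<in>{1 + 1..r}. phase (?g \<alpha> i) ^ k)"
        unfolding S_def by simp
      also have "(\<Sum>i\<in>{1 + 1..r}. phase (?g \<alpha> i) ^ k) = (\<Sum>i\<in>{1 + 1..r}. phase (\<gamma>' i) ^ k)"
        by (intro sum.cong) (auto simp: merge_def)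
      also have "?g \<alpha> 1 = \<alpha> 1" by (simp add: merge_def)
      finally show ?thesis .
    qed
    have "\<exists>\<alpha>\<in>SO_tuples {1..1}. S k \<alpha> \<noteq> 0"
    proof (cases "k = 0")
      case True
      then have "S k (\<lambda>i\<in>{1..1}. mat 1) = of_nat r" by (simp add: S_def)
      then have "S k (\<lambda>i\<in>{1..1}. mat 1) \<noteq> 0" using r by simp
      moreover have "(\<lambda>i\<in>{1..1}. mat 1) \<in> SO_tuples {1..1}" by (simp add: SO_tuples_def SO_one)
      ultimately show ?thesis by blast
    next
      case False
      obtain g where g: "g \<in> SO" "phase g = cis (pi / real k)" using ex_rotation_phase[of "cis (pi / real k)"] by auto
      obtain e where e: "e \<in> SO" "phase e = 1" using ex_rotation_phase[of 1] by auto
      have "phase g ^ k = - 1" using False by (simp add: g(2) Complex.DeMoivre)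
      moreover have "phase e ^ k = 1" by (simp add: e(2))
      ultimately have "S k (\<lambda>i\<in>{1..1}. g) - S k (\<lambda>i\<in>{1..1}. e) = - 2" unfolding S_eq by simp
      then have "S k (\<lambda>i\<in>{1..1}. g) \<noteq> 0 \<or> S k (\<lambda>i\<in>{1..1}. e) \<noteq> 0" by fastforce
      moreover have "(\<lambda>i\<in>{1..1}. g) \<in> SO_tuples {1..1}" "(\<lambda>i\<in>{1..1}. e) \<in> SO_tuples {1..1}"
        using g(1) e(1) by (simp_all add: SO_tuples_def)
      ultimately show ?thesis by blast
    qed
    then show "\<exists>\<alpha>\<in>SO_tuples {1..1}. F k \<alpha> \<noteq> 0" by (simp only: F0)
  next
    fix \<alpha> assume \<alpha>: "\<alpha> \<in> dividing_section r 1 \<gamma>'"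
    obtain h :: "real ^ 'd \<Rightarrow> real" where h: "integrable spherical_measure h"
      "AE v in spherical_measure. (\<Sum>i=1..r. act (?g \<alpha> i) h v) = 0"
      "\<not> (AE v in spherical_measure. h v = 0)"
      using dividing_sectionE[OF \<alpha> \<gamma>'] r by auto
    have SO: "?g \<alpha> i \<in> SO" if "i \<in> {1..r}" for i
      using \<alpha> merge_in_SO[OF _ \<gamma>' that] by (auto simp: dividing_section_def)
    define c where "c k = (\<integral>v. h v *\<^sub>R to_complex v ^ k \<partial>spherical_measure)" for k
    obtain k where k: "c k \<noteq> 0"
      using AE_zero_if_fourier_coefficients_zero[OF h(1)] h(3) by (auto simp: c_def)
    have "(\<integral>v. h v *\<^sub>R to_complex (?g \<alpha> i *v v) ^ k \<partial>spherical_measure) = phase (?g \<alpha> i) ^ k * c k"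
      if "i \<in> {1..r}" for i
    proof -
      have "(\<integral>v. h v *\<^sub>R to_complex (?g \<alpha> i *v v) ^ k \<partial>spherical_measure)
          = (\<integral>v. phase (?g \<alpha> i) ^ k * (h v *\<^sub>R to_complex v ^ k) \<partial>spherical_measure)"
        by (simp only: to_complex_mult_vec[OF SO[OF that]] power_mult_distrib mult_scaleR_right)
      then show ?thesis unfolding c_def by (simp only: integral_mult_right_zero)
    qed
    moreover have "continuous_on UNIV (\<lambda>v. to_complex v ^ k)"
      by (intro continuous_intros continuous_on_to_complex)
    ultimately have "(\<Sum>i=1..r. phase (?g \<alpha> i) ^ k * c k) = 0"
      using moment_relation[OF SO h(1,2), of "\<lambda>v. to_complex v ^ k"] by simp
    then have "S k \<alpha> * c k = 0" by (simp add: S_def sum_distrib_right)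
    then have "S k \<alpha> = 0" using k by simp
    then show "\<exists>k. F k \<alpha> = 0" using F0 by blast
  qed (simp, rule F, auto simp: dividing_section_def)
qed

end

section \<open>The two bounds\<close>

theorem theorem1p2:
  fixes r :: nat
  assumes "CARD('d::finite) \<ge> 2" and "r \<ge> 2"
  shows "f_top TYPE('d) r \<le> (if CARD('d) \<ge> 3 then r div 2 else 1) \<and>
         f_haar TYPE('d) r \<le> (if CARD('d) \<ge> 3 then r div 2 else 1)"
proof -
  define l where "l = (if CARD('d) \<ge> 3 then r div 2 else 1)"
  have main: "meager_in (SO_power_top {1..l}) (dividing_section r l \<gamma>') \<and>
    haar_null (SO_power {1..l}) (SO_power_top {1..l}) (dividing_section r l \<gamma>')"
    if \<gamma>': "\<gamma>' \<in> SO_tuples {l + 1..r}" for \<gamma>' :: "nat \<Rightarrow> real ^ 'd ^ 'd"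
  proof (cases "CARD('d) \<ge> 3")
    case True
    show ?thesis
      by (rule dividing_section_negligible_half[OF _ _ \<gamma>']) (use True assms(2) in \<open>auto simp: l_def\<close>)
  next
    case False
    then have l: "l = 1" and "CARD('d) = 2" using assms(1) by (auto simp: l_def)
    then obtain a b :: 'd where "a \<noteq> b" "UNIV = {a, b}" by (metis card_2_iff)
    then interpret plane a b by unfold_locales
    show ?thesis
      using dividing_section_negligible_plane[of r \<gamma>'] \<gamma>' assms(2) unfolding l by simp
  qed
  have "l \<le> r" using assms by (auto simp: l_def)
  then show ?thesis
    unfolding f_top_def f_haar_def l_def[symmetric] using main by (intro conjI Least_le) blast+
qed

end
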